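(* Let $R\ge1$, $k,d,W,L,M\in\mathbb N$, $a,b,\alpha,\beta\in\mathbb R$ with $a<b$ and $\beta-\alpha\ge1$, and let $\Theta$ be the $k$-dimensional parameter space corresponding to $(\alpha,\beta)$-clipped ReLU neural networks $\Phi_\theta$ such that $\mathcal W(\Phi_\theta)\le W$, $\mathcal L(\Phi_\theta)\le L$ and $\mathcal B(\Phi_\theta)\le R$ for all $\theta\in\Theta$. Let $D=[a,b]$, $Y=[0,1]^d$, and let $D\times Y$ be the domain of the solution functions $u_\theta$ associated to the networks $\Phi_\theta$. Let $\mu$ be a probability measure on $Y$, let training sets $\mathcal S=(y_1,\dots,y_M)$ of size $M$ be drawn according to $\mu^M$, let $T>0$ and let $u(T,\cdot,y)$ be the solution at time $T$ of the parametric scalar conservation law described in the context. Let $\theta^*(\mathcal S)\in\Theta$ be the minimizer over $\Theta$ of the training loss defined in the context, and let $\overline{\mathcal E}_T$ and $\overline{\mathcal E}_G$ be the cumulative training error and the cumulative generalization error defined in the context. Then $$\overline{\mathcal E}_G\le\overline{\mathcal E}_T+\frac{12(\beta-\alpha)(b-a)L(W+1)^2\sqrt{\ln(2MR)}}{\sqrt M}.$$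
   Context: **ReLU networks.** $\sigma(x)=\max\{x,0\}$, applied componentwise. For depth $L'\in\mathbb N$, widths $l_0,\dots,l_{L'}\in\mathbb N$ and $\theta=((W_k,b_k))_{k=1}^{L'}$ with $W_k\in\mathbb R^{l_k\times l_{k-1}}$, $b_k\in\mathbb R^{l_k}$, put $\mathcal A_k(x)=W_kx+b_k$; the ReLU network with parameter $\theta$ is $\Phi_\theta=\mathcal A_{L'}\circ\sigma\circ\mathcal A_{L'-1}\circ\sigma\circ\cdots\circ\sigma\circ\mathcal A_1:\mathbb R^{l_0}\to\mathbb R^{l_{L'}}$ ($\Phi_\theta=\mathcal A_1$ if $L'=1$). Depth $\mathcal L(\Phi_\theta)=L'$; maximum width $\mathcal W(\Phi_\theta)=\max_{0\le k\le L'}l_k$; weight magnitude $\mathcal B(\Phi_\theta)=\|\theta\|_\infty$ (largest absolute value of an entry of the $W_k,b_k$). The parameter space $\Theta$ is $k$-dimensional, i.e. it corresponds to an architecture with $k$ parameters. **Clipped networks.** $\Phi_\theta$ is $(\alpha,\beta)$-clipped if $\Phi_\theta(y)\in[\alpha,\beta]^{l_{L'}}$ for all $y$ in the input domain, here $Y=[0,1]^d$. **Associated solution function.** For a ReLU network $\Phi_\theta$ with input dimension $d$ and output dimension $J$, put $x_{j+1/2}=a+j(b-a)/J$ and $C_j=[x_{j-1/2},x_{j+1/2})$; then $u_\theta:D\times Y\to\mathbb R$ is given by $u_\theta(x,y)=(\Phi_\theta(y))_j$ for $x\in C_j$, $1\le j\le J$, $y\in Y$. **Conservation law.** $u(t,x,y)$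 denotes the solution of the one-dimensional scalar conservation law $\partial_tu+\partial_xf(u,y)=0$, $u(0,x,y)=u_0(x,y)$, for $x\in D$, $t\in[0,T]$, where $y\in Y$ collects the parameters of both the flux and the initial data. **Errors.** $(Y,\Sigma,\mu)$ is a complete probability space. For $\theta\in\Theta$ and $\mathcal S=(y_1,\dots,y_M)\in Y^M$, $$\mathcal E_T(\theta,\mathcal S)=\frac1M\sum_{i=1}^M\|u(T,\cdot,y_i)-u_\theta(\cdot,y_i)\|_{L^1(D)},\qquad\mathcal E_G(\theta)=\int_Y\|u(T,\cdot,y)-u_\theta(\cdot,y)\|_{L^1(D)}\,d\mu(y).$$ The training loss is $\mathcal J(\theta;\mathcal S,\lambda)=\mathcal E_T(\theta,\mathcal S)+\lambda\mathcal R(\theta)$, with a regularization parameter $\lambda>0$ and a regularization function $\mathcal R$ (a popular choice is $\mathcal R(\theta)=\|\theta\|_p^p$, $p=1,2$), and $\theta^*(\mathcal S)=\arg\min_{\theta\in\Theta}\mathcal J(\theta;\mathcal S,\lambda)$. The cumulative errors are $$\overline{\mathcal E}_T=\int_{Y^M}\mathcal E_T(\theta^*(\mathcal S),\mathcal S)\,d\mu^M(\mathcal S),\qquad\overline{\mathcal E}_G=\int_{Y^M}\mathcal E_G(\theta^*(\mathcal S))\,d\mu^M(\mathcal S).$$ *)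

theory Defs
  imports "HOL-Probability.Probability" "Jordan_Normal_Form.Matrix"
begin

section \<open>ReLU networks\<close>

text \<open>
  A parameter is the list of layers \<open>(W_1, b_1), \<dots>, (W_n, b_n)\<close>, where \<open>n\<close> is the depth;
  an architecture is the list of widths \<open>[l_0, \<dots>, l_n]\<close>, so it is one entry longer.
\<close>

type_synonym params = "(real mat \<times> real vec) list"

definition architecture :: "nat list \<Rightarrow> bool" where
  "architecture l \<longleftrightarrow> 2 \<le> length l \<and> (\<forall>n\<in>set l. 0 < n)"

definition params_of :: "nat list \<Rightarrow> params set" where
  "params_of l = {\<theta>. Suc (length \<theta>) = length l \<and>
     (\<forall>i<length \<theta>. \<theta> ! i \<in> carrier_mat (l ! Suc i) (l ! i) \<times> carrier_vec (l ! Suc i))}"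

definition num_params :: "nat list \<Rightarrow> nat" where
  "num_params l = (\<Sum>i<length l - 1. l ! Suc i * l ! i + l ! Suc i)"

definition relu :: "real vec \<Rightarrow> real vec" where
  "relu v = map_vec (\<lambda>x. max x 0) v"

fun relu_net :: "params \<Rightarrow> real vec \<Rightarrow> real vec" where
  "relu_net [] v = v"
| "relu_net [(A, b)] v = A *\<^sub>v v + b"
| "relu_net ((A, b) # p # \<theta>) v = relu_net (p # \<theta>) (relu (A *\<^sub>v v + b))"

definition depth :: "params \<Rightarrow> nat" where
  "depth \<theta> = length \<theta>"

text \<open>The input width \<open>l_0\<close> is included, as the column dimension of the first matrix.\<close>

definition max_width :: "params \<Rightarrow> nat" where
  "max_width \<theta> = Max (\<Union>(A, b)\<in>set \<theta>. {dim_row A, dim_col A})"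

definition weight_magnitude :: "params \<Rightarrow> real" where
  "weight_magnitude \<theta> = Max (\<Union>(A, b)\<in>set \<theta>. abs ` (elements_mat A \<union> vec_set b))"

text \<open>
  Points of \<open>[0,1]\<^sup>d\<close> are functions on \<open>{..<d}\<close> (extended by \<open>undefined\<close>), so that the product
  \<open>\<sigma>\<close>-algebras of the library apply; \<open>vec d y\<close> is the corresponding network input.
\<close>

definition unit_cube :: "nat \<Rightarrow> (nat \<Rightarrow> real) set" where
  "unit_cube d = (\<Pi>\<^sub>E i\<in>{..<d}. {0..1})"

definition clipped :: "real \<Rightarrow> real \<Rightarrow> nat \<Rightarrow> params \<Rightarrow> bool" where
  "clipped \<alpha> \<beta> d \<theta> \<longleftrightarrow> (\<forall>y\<in>unit_cube d. vec_set (relu_net \<theta> (vec d y)) \<subseteq> {\<alpha>..\<beta>})"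

section \<open>The associated solution function\<close>

text \<open>\<open>grid a b J j\<close> is \<open>x\<^bsub>j+1/2\<^esub> = a + j(b-a)/J\<close>; cells are numbered \<open>1, \<dots>, J\<close>.\<close>

definition grid :: "real \<Rightarrow> real \<Rightarrow> nat \<Rightarrow> nat \<Rightarrow> real" where
  "grid a b J j = a + real j * (b - a) / real J"

definition cell :: "real \<Rightarrow> real \<Rightarrow> nat \<Rightarrow> nat \<Rightarrow> real set" where
  "cell a b J j = {grid a b J (j - 1) ..< grid a b J j}"

text \<open>
  The cells are disjoint with union \<open>[a,b)\<close>, so at most one summand is nonzero. The cells leave
  the value at the null set \<open>{b}\<close> unspecified; it is \<open>0\<close> here. Vector entries are numbered from
  \<open>0\<close>, hence the index \<open>j - 1\<close>.
\<close>

definition net_solution ::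
  "real \<Rightarrow> real \<Rightarrow> nat \<Rightarrow> nat \<Rightarrow> params \<Rightarrow> real \<Rightarrow> (nat \<Rightarrow> real) \<Rightarrow> real" where
  "net_solution a b d J \<theta> x y =
     (\<Sum>j = 1..J. indicator (cell a b J j) x * relu_net \<theta> (vec d y) $ (j - 1))"

section \<open>Scalar conservation laws\<close>

text \<open>
  Nonnegative test functions of class \<open>C\<^sup>1\<close> with compact support in \<open>(0,T) \<times> (a,b)\<close>, together
  with their partial derivatives in \<open>t\<close> and \<open>x\<close>.
\<close>

definition test_function :: "real \<Rightarrow> real \<Rightarrow> real \<Rightarrow> (real \<Rightarrow> real \<Rightarrow> real) \<Rightarrow>
    (real \<Rightarrow> real \<Rightarrow> real) \<Rightarrow> (real \<Rightarrow> real \<Rightarrow> real) \<Rightarrow> bool" where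
  "test_function T a b \<phi> \<phi>t \<phi>x \<longleftrightarrow>
     (\<forall>t x. 0 \<le> \<phi> t x) \<and>
     (\<forall>t x. ((\<lambda>s. \<phi> s x) has_real_derivative \<phi>t t x) (at t)) \<and>
     (\<forall>t x. (\<phi> t has_real_derivative \<phi>x t x) (at x)) \<and>
     continuous_on UNIV (\<lambda>(t, x). \<phi>t t x) \<and>
     continuous_on UNIV (\<lambda>(t, x). \<phi>x t x) \<and>
     (\<exists>K. compact K \<and> K \<subseteq> {0<..<T} \<times> {a<..<b} \<and> (\<forall>t x. (t, x) \<notin> K \<longrightarrow> \<phi> t x = 0))"

text \<open>
  Kruzkov entropy solutions of \<open>\<partial>\<^sub>t u + \<partial>\<^sub>x f(u) = 0\<close> on \<open>[0,T] \<times> [a,b]\<close> with initial datum \<open>u0\<close>: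
  \<open>u\<close> is bounded, belongs to \<open>C([0,T]; L\<^sup>1(a,b))\<close> (so that \<open>u(t, \<cdot>)\<close> makes sense for every
  \<open>t\<close>), attains the datum, and satisfies \<open>\<partial>\<^sub>t\<bar>u - c\<bar> + \<partial>\<^sub>x(sgn(u - c)(f(u) - f(c))) \<le> 0\<close> in the
  sense of distributions for all \<open>c\<close>. Taking \<open>\<bar>c\<bar>\<close> large shows that \<open>u\<close> is a weak solution.
  No boundary condition is imposed, so the solutions of the problem with any lateral boundary
  conditions, and restrictions of solutions of the Cauchy problem, are all covered.
\<close>

definition entropy_solution :: "real \<Rightarrow> real \<Rightarrow> real \<Rightarrow> (real \<Rightarrow> real) \<Rightarrow> (real \<Rightarrow> real) \<Rightarrow>
    (real \<Rightarrow> real \<Rightarrow> real) \<Rightarrow> bool" where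
  "entropy_solution T a b f u0 u \<longleftrightarrow>
     (\<lambda>(t, x). u t x) \<in> borel_measurable (lebesgue_on ({0..T} \<times> {a..b})) \<and>
     integrable (lebesgue_on ({0..T} \<times> {a..b})) (\<lambda>(t, x). f (u t x)) \<and>
     (\<forall>t\<in>{0..T}. u t \<in> borel_measurable (lebesgue_on {a..b})) \<and>
     (\<exists>K. \<forall>t\<in>{0..T}. AE x in lebesgue_on {a..b}. \<bar>u t x\<bar> \<le> K) \<and>
     (\<forall>t\<in>{0..T}. ((\<lambda>s. LINT x|lebesgue_on {a..b}. \<bar>u s x - u t x\<bar>) \<longlongrightarrow> 0) (at t within {0..T})) \<and>
     (AE x in lebesgue_on {a..b}. u 0 x = u0 x) \<and>
     (\<forall>c \<phi> \<phi>t \<phi>x. test_function T a b \<phi> \<phi>t \<phi>x \<longrightarrow>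
        0 \<le> (LINT (t, x)|lebesgue_on ({0..T} \<times> {a..b}).
               \<bar>u t x - c\<bar> * \<phi>t t x + sgn (u t x - c) * (f (u t x) - f c) * \<phi>x t x))"

section \<open>Errors\<close>

definition L1_dist :: "real \<Rightarrow> real \<Rightarrow> (real \<Rightarrow> real) \<Rightarrow> (real \<Rightarrow> real) \<Rightarrow> real" where
  "L1_dist a b g h = (LINT x|lebesgue_on {a..b}. \<bar>g x - h x\<bar>)"

text \<open>
  In the following, \<open>v x y\<close> stands for \<open>u(T,x,y)\<close>. A training set of size \<open>M\<close> is a function
  on \<open>{1..M}\<close>, and \<open>\<mu>\<^sup>M\<close> is \<open>\<Pi>\<^sub>M i\<in>{1..M}. \<mu>\<close>.
\<close>

definition train_error :: "real \<Rightarrow> real \<Rightarrow> nat \<Rightarrow> nat \<Rightarrow> (real \<Rightarrow> (nat \<Rightarrow> real) \<Rightarrow> real) \<Rightarrow>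
    nat \<Rightarrow> params \<Rightarrow> (nat \<Rightarrow> nat \<Rightarrow> real) \<Rightarrow> real" where
  "train_error a b d J v M \<theta> S =
     (1 / real M) * (\<Sum>i = 1..M. L1_dist a b (\<lambda>x. v x (S i)) (\<lambda>x. net_solution a b d J \<theta> x (S i)))"

definition gen_error :: "real \<Rightarrow> real \<Rightarrow> nat \<Rightarrow> nat \<Rightarrow> (real \<Rightarrow> (nat \<Rightarrow> real) \<Rightarrow> real) \<Rightarrow>
    (nat \<Rightarrow> real) measure \<Rightarrow> params \<Rightarrow> real" where
  "gen_error a b d J v \<mu> \<theta> =
     (LINT y|\<mu>. L1_dist a b (\<lambda>x. v x y) (\<lambda>x. net_solution a b d J \<theta> x y))"

definition train_loss :: "real \<Rightarrow> real \<Rightarrow> nat \<Rightarrow> nat \<Rightarrow> (real \<Rightarrow> (nat \<Rightarrow> real) \<Rightarrow> real) \<Rightarrow>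
    nat \<Rightarrow> real \<Rightarrow> (params \<Rightarrow> real) \<Rightarrow> (nat \<Rightarrow> nat \<Rightarrow> real) \<Rightarrow> params \<Rightarrow> real" where
  "train_loss a b d J v M lam \<R> S \<theta> = train_error a b d J v M \<theta> S + lam * \<R> \<theta>"

definition cum_train_error :: "real \<Rightarrow> real \<Rightarrow> nat \<Rightarrow> nat \<Rightarrow> (real \<Rightarrow> (nat \<Rightarrow> real) \<Rightarrow> real) \<Rightarrow>
    (nat \<Rightarrow> real) measure \<Rightarrow> nat \<Rightarrow> ((nat \<Rightarrow> nat \<Rightarrow> real) \<Rightarrow> params) \<Rightarrow> real" where
  "cum_train_error a b d J v \<mu> M \<theta>s =
     (LINT S|(\<Pi>\<^sub>M i\<in>{1..M}. \<mu>). train_error a b d J v M (\<theta>s S) S)"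

definition cum_gen_error :: "real \<Rightarrow> real \<Rightarrow> nat \<Rightarrow> nat \<Rightarrow> (real \<Rightarrow> (nat \<Rightarrow> real) \<Rightarrow> real) \<Rightarrow>
    (nat \<Rightarrow> real) measure \<Rightarrow> nat \<Rightarrow> ((nat \<Rightarrow> nat \<Rightarrow> real) \<Rightarrow> params) \<Rightarrow> real" where
  "cum_gen_error a b d J v \<mu> M \<theta>s =
     (LINT S|(\<Pi>\<^sub>M i\<in>{1..M}. \<mu>). gen_error a b d J v \<mu> (\<theta>s S))"

end

theory Submission
  imports Defs
begin

text \<open>
  The loss of two clipped networks differs by at most \<open>C = (b - a)(\<beta> - \<alpha>)\<close>, even though the loss
  itself need not be bounded. Subtracting the loss of one fixed network therefore leaves bounded
  random variables, and the linear term that is split off has the same mean on the sample and on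
  the whole space. Hoeffding's lemma bounds the exponential moments of the sample deviations, and a
  union bound over a finite internal cover of \<open>\<Theta>\<close> with at most \<open>exp H\<close> elements and mesh \<open>e\<close>
  in the loss gives the error \<open>2 e + C sqrt (2 H / M)\<close>. Since the network output is Lipschitz in the
  weights with constant \<open>L (R (W + 1))\<^sup>L\<close>, rounding the \<open>k \<le> L W (W + 1)\<close> weights to a grid
  yields \<open>e \<le> (b - a) / (2 M)\<close> with \<open>H\<close> of order \<open>L\<^sup>2 (W + 1)\<^sup>4 ln (2 M R)\<close>.
\<close>

unbundle no vec_syntax

section \<open>Generalization error over a finite cover\<close>

text \<open>Hoeffding's lemma for \<open>- Z\<close>, whose values lie in an interval of length
  \<open>2 * C\<close>: the exponent is \<open>s\<^sup>2 * (2 * C)\<^sup>2 / 8\<close>. The sign is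
  that of true mean minus sampled value, because the generalization error is to be bounded from
  above.\<close>

lemma (in prob_space) expectation_exp_centered_le:
  fixes Z :: "'a \<Rightarrow> real"
  assumes Z [measurable]: "Z \<in> borel_measurable M"
    and bd: "\<And>y. y \<in> space M \<Longrightarrow> \<bar>Z y\<bar> \<le> C" and s: "0 < s"
  shows "integrable M (\<lambda>y. exp (s * (expectation Z - Z y)))"
    and "expectation (\<lambda>y. exp (s * (expectation Z - Z y))) \<le> exp (s\<^sup>2 * C\<^sup>2 / 2)"
proof -
  have int: "integrable M Z"
    by (rule integrable_const_bound[where B=C]) (auto intro!: AE_I2 bd)
  interpret interval_bounded_random_variable M "\<lambda>y. - Z y" "- C" C
    by unfold_locales (use bd in \<open>fastforce intro!: AE_I2 simp: abs_le_iff\<close>)+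
  have EZ: "\<bar>expectation Z\<bar> \<le> C"
  proof -
    have "\<bar>expectation Z\<bar> \<le> expectation (\<lambda>y. \<bar>Z y\<bar>)"
      by (rule integral_abs_bound)
    also have "\<dots> \<le> expectation (\<lambda>_. C)"
      using int bd by (intro integral_mono) auto
    finally show ?thesis by (simp add: prob_space)
  qed
  show I: "integrable M (\<lambda>y. exp (s * (expectation Z - Z y)))"
  proof (rule integrable_const_bound[where B="exp (s * (2 * C))"])
    show "AE y in M. norm (exp (s * (expectation Z - Z y))) \<le> exp (s * (2 * C))"
    proof (rule AE_I2)
      fix y assume "y \<in> space M"
      then have "s * (expectation Z - Z y) \<le> s * (2 * C)"
        using EZ bd[of y] s by (intro mult_left_mono) (auto simp: abs_le_iff)
      then show "norm (exp (s * (expectation Z - Z y))) \<le> exp (s * (2 * C))" by simp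
    qed
  qed measurable
  have "(\<integral>\<^sup>+ x. ennreal (exp (s * (- Z x - expectation (\<lambda>y. - Z y)))) \<partial>M)
      \<le> ennreal (exp (s\<^sup>2 * (C - - C)\<^sup>2 / 8))"
    by (rule Hoeffdings_lemma_nn_integral[OF s])
  then have "ennreal (expectation (\<lambda>y. exp (s * (expectation Z - Z y))))
      \<le> ennreal (exp (s\<^sup>2 * C\<^sup>2 / 2))"
    by (subst nn_integral_eq_integral[symmetric, OF I]) (auto simp: power2_eq_square mult_ac)
  then show "expectation (\<lambda>y. exp (s * (expectation Z - Z y))) \<le> exp (s\<^sup>2 * C\<^sup>2 / 2)"
    by (subst (asm) ennreal_le_iff) auto
qed

text \<open>A coordinate of the product space has law \<open>M\<close>. Hence the sample mean of an
  integrable, possibly unbounded loss is unbiased, which is what removes the reference loss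
  later.\<close>

lemma (in prob_space)
  fixes X :: "'a \<Rightarrow> real"
  assumes "integrable M X" and "i \<in> I"
  shows integrable_PiM_component: "integrable (\<Pi>\<^sub>M i\<in>I. M) (\<lambda>S. X (S i))"
    and integral_PiM_component: "(LINT S|(\<Pi>\<^sub>M i\<in>I. M). X (S i)) = expectation X"
proof -
  have D: "distr (\<Pi>\<^sub>M i\<in>I. M) M (\<lambda>S. S i) = M"
    by (rule distr_PiM_component) (use assms prob_space_axioms in auto)
  have m: "(\<lambda>S. S i) \<in> measurable (\<Pi>\<^sub>M i\<in>I. M) M"
    using assms(2) by measurable
  show "integrable (\<Pi>\<^sub>M i\<in>I. M) (\<lambda>S. X (S i))"
    using assms(1) integrable_distr[OF m, of X] by (simp add: D)
  show "(LINT S|(\<Pi>\<^sub>M i\<in>I. M). X (S i)) = expectation X"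
    using integral_distr[OF m, of X] assms(1) by (simp add: D)
qed

text \<open>The exponential of a sample mean is a product over the coordinates, so its integral
  factorizes. Each of the \<open>n\<close> factors is taken at \<open>s / real n\<close>, and the
  exponents \<open>(s / real n)\<^sup>2 * C\<^sup>2 / 2\<close> add up to the stated one.\<close>

lemma (in prob_space) expectation_exp_sample_deviation_le:
  fixes Z :: "'a \<Rightarrow> real"
  assumes Z: "Z \<in> borel_measurable M"
    and bd: "\<And>y. y \<in> space M \<Longrightarrow> \<bar>Z y\<bar> \<le> C" and s: "0 < s" and n: "0 < n"
  defines "D \<equiv> \<lambda>S. (1 / real n) * (\<Sum>i = 1..n. expectation Z - Z (S i))"
  shows "integrable (\<Pi>\<^sub>M i\<in>{1..n}. M) (\<lambda>S. exp (s * D S))"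
    and "(LINT S|(\<Pi>\<^sub>M i\<in>{1..n}. M). exp (s * D S)) \<le> exp (s\<^sup>2 * C\<^sup>2 / (2 * real n))"
proof -
  interpret P: product_sigma_finite "\<lambda>_::nat. M"
    by standard
  let ?g = "\<lambda>y. exp ((s / real n) * (expectation Z - Z y))"
  have sn: "0 < s / real n" using s n by simp
  note E = expectation_exp_centered_le[OF Z bd sn]
  have eq: "exp (s * D S) = (\<Prod>i\<in>{1..n}. ?g (S i))" for S
    by (simp add: D_def exp_sum[symmetric] sum_distrib_left mult.assoc)
  show "integrable (\<Pi>\<^sub>M i\<in>{1..n}. M) (\<lambda>S. exp (s * D S))"
    unfolding eq by (rule P.product_integrable_prod) (use E(1) in auto)
  have "(LINT S|(\<Pi>\<^sub>M i\<in>{1..n}. M). exp (s * D S)) = (\<Prod>i\<in>{1..n}. expectation ?g)"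
    unfolding eq by (rule P.product_integral_prod) (use E(1) in auto)
  also have "\<dots> \<le> (\<Prod>i\<in>{1..n}. exp ((s / real n)\<^sup>2 * C\<^sup>2 / 2))"
    by (rule prod_mono) (use E(2) in auto)
  also have "\<dots> = exp (s\<^sup>2 * C\<^sup>2 / (2 * real n))"
    using n by (simp add: exp_of_nat_mult[symmetric] power2_eq_square)
  finally show "(LINT S|(\<Pi>\<^sub>M i\<in>{1..n}. M). exp (s * D S)) \<le> exp (s\<^sup>2 * C\<^sup>2 / (2 * real n))" .
qed

text \<open>
  The maximum over the cover is handled by \<open>\<tau> \<le> ln A - 1 + exp \<tau> / A\<close>, which linearises the
  logarithm in the usual bound \<open>E max \<le> ln (E exp max)\<close> and so avoids Jensen's inequality.
\<close>

lemma (in prob_space) generalization_error_le_cover: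
  fixes X :: "'p \<Rightarrow> 'a \<Rightarrow> real" and \<theta>s :: "(nat \<Rightarrow> 'a) \<Rightarrow> 'p" and n :: nat
  defines "P \<equiv> \<Pi>\<^sub>M i\<in>{1..n}. M"
  assumes n: "0 < n" and C: "0 < C" and H: "0 < H"
    and int: "\<And>\<theta>. \<theta> \<in> \<Theta> \<Longrightarrow> integrable M (X \<theta>)"
    and bd: "\<And>\<theta> \<theta>' y. \<lbrakk>\<theta> \<in> \<Theta>; \<theta>' \<in> \<Theta>; y \<in> space M\<rbrakk> \<Longrightarrow> \<bar>X \<theta> y - X \<theta>' y\<bar> \<le> C"
    and N: "finite N" "N \<subseteq> \<Theta>" "ln (real (card N)) \<le> H"
    and cover: "\<And>\<theta>. \<theta> \<in> \<Theta> \<Longrightarrow> \<exists>\<theta>'\<in>N. \<forall>y\<in>space M. \<bar>X \<theta> y - X \<theta>' y\<bar> \<le> e"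
    and \<theta>s: "\<And>S. S \<in> space P \<Longrightarrow> \<theta>s S \<in> \<Theta>"
    and emp_meas: "(\<lambda>S. (1 / real n) * (\<Sum>i = 1..n. X (\<theta>s S) (S i))) \<in> borel_measurable P"
    and exp_meas: "(\<lambda>S. expectation (X (\<theta>s S))) \<in> borel_measurable P"
  shows "(LINT S|P. expectation (X (\<theta>s S)))
    \<le> (LINT S|P. (1 / real n) * (\<Sum>i = 1..n. X (\<theta>s S) (S i))) + 2 * e + C * sqrt (2 * H / real n)"
proof -
  have "prob_space P"
    unfolding P_def by (intro prob_space_PiM prob_space_axioms)
  then interpret P: prob_space P .
  obtain S0 where S0: "S0 \<in> space P" using P.not_empty by blast
  define \<theta>0 where "\<theta>0 = \<theta>s S0"
  have \<theta>0: "\<theta>0 \<in> \<Theta>" using \<theta>s[OF S0] by (simp add: \<theta>0_def)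
  have sp: "S i \<in> space M" if "S \<in> space P" "i \<in> {1..n}" for S i
    using that by (auto simp: P_def space_PiM)
  have N0: "N \<noteq> {}" using cover[OF \<theta>0] by auto
  \<comment> \<open>Subtracting the reference loss leaves variables bounded by \<open>C\<close>, as
    the exponential moment bound demands; \<open>X \<theta>\<close> itself is only known to be
    integrable.\<close>
  define Z where "Z \<theta> y = X \<theta> y - X \<theta>0 y" for \<theta> y
  have Zint: "integrable M (Z \<theta>)" if "\<theta> \<in> \<Theta>" for \<theta>
    using int[OF that] int[OF \<theta>0] by (simp add: Z_def[abs_def])
  have EZ: "expectation (Z \<theta>) = expectation (X \<theta>) - expectation (X \<theta>0)" if "\<theta> \<in> \<Theta>" for \<theta>
    using int[OF that] int[OF \<theta>0] by (simp add: Z_def[abs_def])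
  have Zbd: "\<bar>Z \<theta> y\<bar> \<le> C" if "\<theta> \<in> \<Theta>" "y \<in> space M" for \<theta> y
    using bd[OF that(1) \<theta>0 that(2)] by (simp add: Z_def)
  have EZbd: "\<bar>expectation (Z \<theta>) - expectation (Z \<theta>')\<bar> \<le> c"
    if "\<theta> \<in> \<Theta>" "\<theta>' \<in> \<Theta>" "\<And>y. y \<in> space M \<Longrightarrow> \<bar>X \<theta> y - X \<theta>' y\<bar> \<le> c" for \<theta> \<theta>' c
  proof -
    have "expectation (Z \<theta>) - expectation (Z \<theta>') = expectation (\<lambda>y. X \<theta> y - X \<theta>' y)"
      using that int by (simp add: EZ)
    also have "\<bar>\<dots>\<bar> \<le> expectation (\<lambda>y. \<bar>X \<theta> y - X \<theta>' y\<bar>)"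
      by (rule integral_abs_bound)
    also have "\<dots> \<le> expectation (\<lambda>_. c)"
      using that int by (intro integral_mono) auto
    finally show ?thesis by (simp add: prob_space)
  qed
  have comp: "integrable P (\<lambda>S. X \<theta>0 (S i))" "(LINT S|P. X \<theta>0 (S i)) = expectation (X \<theta>0)"
    if "i \<in> {1..n}" for i
    unfolding P_def using integrable_PiM_component[OF int[OF \<theta>0] that]
      integral_PiM_component[OF int[OF \<theta>0] that] by auto
  define emp where "emp \<theta> S = (1 / real n) * (\<Sum>i = 1..n. X \<theta> (S i))" for \<theta> S
  have emp0: "integrable P (emp \<theta>0)" "(LINT S|P. emp \<theta>0 S) = expectation (X \<theta>0)"
  proof -
    show "integrable P (emp \<theta>0)"
      unfolding emp_def[abs_def] using comp by (intro integrable_mult_right Bochner_Integration.integrable_sum) auto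
    show "(LINT S|P. emp \<theta>0 S) = expectation (X \<theta>0)"
      unfolding emp_def[abs_def] using comp n
      by (subst integral_mult_right_zero) (simp add: Bochner_Integration.integral_sum)
  qed
  have gint: "integrable P (\<lambda>S. expectation (X (\<theta>s S)))"
  proof (rule P.integrable_const_bound[where B="C + \<bar>expectation (X \<theta>0)\<bar>"])
    show "AE S in P. norm (expectation (X (\<theta>s S))) \<le> C + \<bar>expectation (X \<theta>0)\<bar>"
    proof (rule AE_I2)
      fix S assume "S \<in> space P"
      then have t: "\<theta>s S \<in> \<Theta>" by (rule \<theta>s)
      have "\<bar>expectation (Z (\<theta>s S)) - expectation (Z \<theta>0)\<bar> \<le> C"
        by (rule EZbd[OF t \<theta>0]) (rule bd[OF t \<theta>0])
      then show "norm (expectation (X (\<theta>s S))) \<le> C + \<bar>expectation (X \<theta>0)\<bar>"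
        using EZ[OF t] EZ[OF \<theta>0] by simp
    qed
  qed (rule exp_meas)
  have emp_diff: "\<bar>emp \<theta> S - emp \<theta>' S\<bar> \<le> c"
    if "S \<in> space P" "\<And>y. y \<in> space M \<Longrightarrow> \<bar>X \<theta> y - X \<theta>' y\<bar> \<le> c" for \<theta> \<theta>' c S
  proof -
    have "\<bar>emp \<theta> S - emp \<theta>' S\<bar> = (1 / real n) * \<bar>\<Sum>i = 1..n. X \<theta> (S i) - X \<theta>' (S i)\<bar>"
      by (simp add: emp_def sum_subtractf abs_mult flip: right_diff_distrib diff_divide_distrib)
    also have "\<dots> \<le> (1 / real n) * (\<Sum>i = 1..n. c)"
      by (intro mult_left_mono order_trans[OF sum_abs] sum_mono that(2) sp[OF that(1)]) auto
    finally show ?thesis using n by simp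
  qed
  have tint: "integrable P (\<lambda>S. emp (\<theta>s S) S)"
  proof (rule Bochner_Integration.integrable_bound)
    show "integrable P (\<lambda>S. C + \<bar>emp \<theta>0 S\<bar>)" using emp0 by auto
    show "(\<lambda>S. emp (\<theta>s S) S) \<in> borel_measurable P" using emp_meas by (simp add: emp_def)
    show "AE S in P. norm (emp (\<theta>s S) S) \<le> norm (C + \<bar>emp \<theta>0 S\<bar>)"
    proof (rule AE_I2)
      fix S assume S: "S \<in> space P"
      have "\<bar>emp (\<theta>s S) S - emp \<theta>0 S\<bar> \<le> C"
        by (rule emp_diff[OF S]) (rule bd[OF \<theta>s[OF S] \<theta>0])
      then show "norm (emp (\<theta>s S) S) \<le> norm (C + \<bar>emp \<theta>0 S\<bar>)" by simp
    qed
  qed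
  define D where "D \<theta> S = (1 / real n) * (\<Sum>i = 1..n. expectation (Z \<theta>) - Z \<theta> (S i))" for \<theta> S
  have D_eq: "D \<theta> S = (expectation (X \<theta>) - emp \<theta> S) - (expectation (X \<theta>0) - emp \<theta>0 S)"
    if "\<theta> \<in> \<Theta>" for \<theta> S
  proof -
    have *: "(\<Sum>i = 1..n. expectation (Z \<theta>) - Z \<theta> (S i))
        = real n * (expectation (X \<theta>) - expectation (X \<theta>0)) - ((\<Sum>i = 1..n. X \<theta> (S i)) - (\<Sum>i = 1..n. X \<theta>0 (S i)))"
      unfolding EZ[OF that] by (simp add: sum_subtractf Z_def)
    show ?thesis
      unfolding D_def emp_def * using n by (simp add: field_simps)
  qed
  \<comment> \<open>This value minimises
    \<open>(H + s\<^sup>2 * C\<^sup>2 / (2 * real n)) / s\<close>; both summands of the numerator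
    are then equal to \<open>H\<close>, whence \<open>ln A = 2 * H\<close> below.\<close>
  define s where "s = sqrt (2 * H * real n) / C"
  have s: "0 < s" using H n C by (simp add: s_def)
  \<comment> \<open>\<open>A\<close> majorizes the mean of \<open>Q\<close>: there are at most
    \<open>exp H\<close> summands, each with mean at most the second factor. Hence
    \<open>- 1 + Q S / A\<close> has nonpositive mean.\<close>
  define A where "A = exp H * exp (s\<^sup>2 * C\<^sup>2 / (2 * real n))"
  have A: "0 < A" by (simp add: A_def)
  define Q where "Q S = (\<Sum>\<theta>\<in>N. exp (s * D \<theta> S))" for S
  have Dexp: "integrable P (\<lambda>S. exp (s * D \<theta> S))"
    "(LINT S|P. exp (s * D \<theta> S)) \<le> exp (s\<^sup>2 * C\<^sup>2 / (2 * real n))" if "\<theta> \<in> N" for \<theta>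
    unfolding D_def P_def
    using expectation_exp_sample_deviation_le[OF borel_measurable_integrable[OF Zint] Zbd s n] that N(2)
    by (auto simp: subset_iff)
  have Qint: "integrable P Q"
    unfolding Q_def[abs_def] using Dexp by (intro Bochner_Integration.integrable_sum) auto
  have cardN: "real (card N) \<le> exp H"
    using N N0 by (metis card_gt_0_iff exp_le_cancel_iff exp_ln of_nat_0_less_iff)
  have "(LINT S|P. Q S) \<le> (\<Sum>\<theta>\<in>N. exp (s\<^sup>2 * C\<^sup>2 / (2 * real n)))"
    unfolding Q_def by (subst Bochner_Integration.integral_sum) (auto intro!: sum_mono Dexp simp del: sum_constant)
  also have "\<dots> \<le> A"
    using cardN by (simp add: A_def)
  finally have QA: "(LINT S|P. Q S) \<le> A" .
  have pw: "expectation (X (\<theta>s S)) \<le> emp (\<theta>s S) S + (expectation (X \<theta>0) - emp \<theta>0 S) + 2 * e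
      + (ln A - 1 + Q S / A) / s" if S: "S \<in> space P" for S
  proof -
    have t: "\<theta>s S \<in> \<Theta>" by (rule \<theta>s[OF S])
    obtain \<theta>' where \<theta>': "\<theta>' \<in> N" "\<And>y. y \<in> space M \<Longrightarrow> \<bar>X (\<theta>s S) y - X \<theta>' y\<bar> \<le> e"
      using cover[OF t] by auto
    have t': "\<theta>' \<in> \<Theta>" using \<theta>' N by auto
    have "\<bar>expectation (Z (\<theta>s S)) - expectation (Z \<theta>')\<bar> \<le> e"
      by (rule EZbd[OF t t']) (rule \<theta>'(2))
    moreover have "\<bar>emp (\<theta>s S) S - emp \<theta>' S\<bar> \<le> e"
      by (rule emp_diff[OF S]) (rule \<theta>'(2))
    \<comment> \<open>One \<open>e\<close> pays for the change of the expectation, the other for the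
      change of the sample mean.\<close>
    ultimately have "D (\<theta>s S) S \<le> D \<theta>' S + 2 * e"
      using EZ[OF t] EZ[OF t'] D_eq[OF t, of S] D_eq[OF t', of S] by linarith
    moreover have "s * D \<theta>' S \<le> ln A - 1 + Q S / A"
    proof -
      have "s * D \<theta>' S = ln (exp (s * D \<theta>' S) / A) + ln A"
        using A by (simp add: ln_div)
      also have "\<dots> \<le> exp (s * D \<theta>' S) / A - 1 + ln A"
        using A by (intro add_mono ln_le_minus_one) auto
      also have "exp (s * D \<theta>' S) / A \<le> Q S / A"
        unfolding Q_def using A \<theta>' N(1)
        by (intro divide_right_mono member_le_sum) auto
      finally show ?thesis by simp
    qed
    then have "D \<theta>' S \<le> (ln A - 1 + Q S / A) / s"
      using s by (simp add: pos_le_divide_eq mult.commute)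
    ultimately show ?thesis using D_eq[OF t, of S] by linarith
  qed
  have "(LINT S|P. expectation (X (\<theta>s S))) \<le> (LINT S|P. emp (\<theta>s S) S
      + (expectation (X \<theta>0) - emp \<theta>0 S) + 2 * e + (ln A - 1 + Q S / A) / s)"
    using gint tint emp0 Qint pw by (intro integral_mono) auto
  \<comment> \<open>The reference contribution
    \<open>expectation (X \<theta>0) - emp \<theta>0 S\<close> integrates to zero.\<close>
  also have "\<dots> = (LINT S|P. emp (\<theta>s S) S) + 2 * e + (ln A - 1 + (LINT S|P. Q S) / A) / s"
    using tint emp0 Qint by (simp add: P.prob_space)
  also have "\<dots> \<le> (LINT S|P. emp (\<theta>s S) S) + 2 * e + ln A / s"
    using QA A s by (intro add_left_mono divide_right_mono) (auto simp: field_simps)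
  also have "ln A / s = C * sqrt (2 * H / real n)"
  proof -
    have "ln A = 2 * H"
      using C n H by (simp add: A_def ln_mult s_def power_divide)
    moreover have "2 * H / sqrt (2 * H * real n) = sqrt (2 * H / real n)"
      using H n by (simp add: real_sqrt_mult real_sqrt_divide field_simps)
    moreover have "ln A / s = C * (ln A / sqrt (2 * H * real n))"
      by (simp add: s_def)
    ultimately show ?thesis by simp
  qed
  finally show ?thesis by (simp add: emp_def)
qed

section \<open>Perturbation of the weights\<close>

text \<open>The bias is column \<open>n\<close> of the augmented weight matrix, so that an affine map is one sum over \<open>c \<le> n\<close>.\<close>

definition coef :: "real mat \<times> real vec \<Rightarrow> nat \<Rightarrow> nat \<Rightarrow> real" where
  "coef p r c = (if c < dim_col (fst p) then fst p $$ (r, c) else snd p $ r)"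

lemma affine_index:
  assumes "A \<in> carrier_mat m n" "b \<in> carrier_vec m" "v \<in> carrier_vec n" "r < m"
  shows "(A *\<^sub>v v + b) $ r = (\<Sum>c\<le>n. coef (A, b) r c * (if c < n then v $ c else 1))"
proof -
  have "(\<Sum>c\<le>n. coef (A, b) r c * (if c < n then v $ c else 1))
      = (\<Sum>c<n. A $$ (r, c) * v $ c) + b $ r"
    using assms by (simp add: lessThan_Suc_atMost[symmetric] coef_def)
  then show ?thesis
    using assms by (simp add: scalar_prod_def lessThan_atLeast0)
qed

lemma params_of_Cons:
  "(A, b) # \<theta> \<in> params_of l \<longleftrightarrow> (\<exists>n m ls. l = n # m # ls \<and> A \<in> carrier_mat m n \<and>
     b \<in> carrier_vec m \<and> \<theta> \<in> params_of (m # ls))"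
proof
  assume *: "(A, b) # \<theta> \<in> params_of l"
  then obtain n m ls where l: "l = n # m # ls"
    by (cases l; cases "tl l") (auto simp: params_of_def)
  show "\<exists>n m ls. l = n # m # ls \<and> A \<in> carrier_mat m n \<and>
     b \<in> carrier_vec m \<and> \<theta> \<in> params_of (m # ls)"
  proof (intro exI conjI)
    show "A \<in> carrier_mat m n" "b \<in> carrier_vec m"
      using * unfolding l params_of_def by force+
    show "\<theta> \<in> params_of (m # ls)"
      using * unfolding l params_of_def by fastforce
  qed (rule l)
next
  assume "\<exists>n m ls. l = n # m # ls \<and> A \<in> carrier_mat m n \<and>
     b \<in> carrier_vec m \<and> \<theta> \<in> params_of (m # ls)"
  then show "(A, b) # \<theta> \<in> params_of l"
    by (auto simp: params_of_def nth_Cons split: nat.split)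
qed

lemma params_of_Nil: "[] \<in> params_of l \<longleftrightarrow> (\<exists>n. l = [n])"
  using length_Suc_conv[of l 0] by (auto simp: params_of_def)

lemma dim_relu [simp]: "dim_vec (relu v) = dim_vec v"
  by (simp add: relu_def)

lemma relu_net_carrier:
  assumes "\<theta> \<in> params_of l" "v \<in> carrier_vec (hd l)"
  shows "relu_net \<theta> v \<in> carrier_vec (last l)"
  using assms
proof (induction \<theta> v arbitrary: l rule: relu_net.induct)
  case (1 v)
  then show ?case by (auto simp: params_of_Nil)
next
  case (2 A b v)
  then show ?case by (auto simp: params_of_Cons params_of_Nil)
next
  case (3 A b p \<theta> v)
  from "3.prems" obtain n m ls where l: "l = n # m # ls" "A \<in> carrier_mat m n"
    "b \<in> carrier_vec m" "p # \<theta> \<in> params_of (m # ls)" by (auto simp: params_of_Cons)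
  have "relu (A *\<^sub>v v + b) \<in> carrier_vec (hd (m # ls))"
    unfolding carrier_vec_def using l(3) by simp
  from "3.IH"[OF l(4) this] show ?case by (simp add: l)
qed

definition coefs_bounded :: "real \<Rightarrow> params \<Rightarrow> bool" where
  "coefs_bounded R \<theta> \<longleftrightarrow> (\<forall>p\<in>set \<theta>. \<forall>r<dim_row (fst p). \<forall>c\<le>dim_col (fst p). \<bar>coef p r c\<bar> \<le> R)"

definition coefs_close :: "real \<Rightarrow> params \<Rightarrow> params \<Rightarrow> bool" where
  "coefs_close \<delta> = list_all2 (\<lambda>p q. \<forall>r<dim_row (fst p). \<forall>c\<le>dim_col (fst p).
     \<bar>coef p r c - coef q r c\<bar> \<le> \<delta>)"

lemma abs_mult_diff_le:
  fixes p q x y :: real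
  shows "\<bar>p * x - q * y\<bar> \<le> \<bar>p\<bar> * \<bar>x - y\<bar> + \<bar>p - q\<bar> * \<bar>y\<bar>"
proof -
  have "p * x - q * y = p * (x - y) + (p - q) * y" by (simp add: algebra_simps)
  then show ?thesis using abs_triangle_ineq[of "p * (x - y)" "(p - q) * y"] by (simp only: abs_mult)
qed

text \<open>Each entry is a sum of \<open>n + 1 \<le> w\<close> products. The bias multiplies the
  constant input 1, which is why \<open>1 \<le> X\<close> is required, and a difference of two
  products splits into a signal error \<open>R * e\<close> and a weight error
  \<open>\<delta> * X\<close>.\<close>

lemma affine_perturbation:
  fixes v v' :: "real vec"
  assumes dims: "A \<in> carrier_mat m n" "b \<in> carrier_vec m" "A' \<in> carrier_mat m n" "b' \<in> carrier_vec m"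
    "v \<in> carrier_vec n" "v' \<in> carrier_vec n"
    and A: "\<And>r c. r < m \<Longrightarrow> c \<le> n \<Longrightarrow> \<bar>coef (A, b) r c\<bar> \<le> R"
    and A': "\<And>r c. r < m \<Longrightarrow> c \<le> n \<Longrightarrow> \<bar>coef (A', b') r c\<bar> \<le> R"
    and close: "\<And>r c. r < m \<Longrightarrow> c \<le> n \<Longrightarrow> \<bar>coef (A, b) r c - coef (A', b') r c\<bar> \<le> \<delta>"
    and v: "\<And>c. c < n \<Longrightarrow> \<bar>v $ c\<bar> \<le> X" and v': "\<And>c. c < n \<Longrightarrow> \<bar>v' $ c\<bar> \<le> X"
    and e: "\<And>c. c < n \<Longrightarrow> \<bar>v $ c - v' $ c\<bar> \<le> e"
    and nonneg: "0 \<le> R" "1 \<le> X" "0 \<le> e" "0 \<le> \<delta>" "real n + 1 \<le> w" and r: "r < m"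
  shows "\<bar>(A *\<^sub>v v + b) $ r\<bar> \<le> R * w * X"
    and "\<bar>(A' *\<^sub>v v' + b') $ r\<bar> \<le> R * w * X"
    and "\<bar>(A *\<^sub>v v + b) $ r - (A' *\<^sub>v v' + b') $ r\<bar> \<le> w * (R * e + \<delta> * X)"
proof -
  let ?v = "\<lambda>c. if c < n then v $ c else 1" and ?v' = "\<lambda>c. if c < n then v' $ c else 1"
  have vX: "\<bar>?v c\<bar> \<le> X" "\<bar>?v' c\<bar> \<le> X" "\<bar>?v c - ?v' c\<bar> \<le> e" for c
    using v v' e nonneg by auto
  have sum_le: "\<bar>\<Sum>c\<le>n. g c\<bar> \<le> w * B" if "\<And>c. c \<le> n \<Longrightarrow> \<bar>g c\<bar> \<le> B" "0 \<le> B" for g :: "nat \<Rightarrow> real" and B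
  proof -
    have "\<bar>\<Sum>c\<le>n. g c\<bar> \<le> (\<Sum>c\<le>n. B)"
      by (intro order_trans[OF sum_abs] sum_mono that) auto
    also have "\<dots> = (real n + 1) * B" by simp
    also have "\<dots> \<le> w * B" using nonneg that by (intro mult_right_mono) auto
    finally show ?thesis .
  qed
  have "\<bar>coef (A, b) r c * ?v c\<bar> \<le> R * X" if "c \<le> n" for c
    unfolding abs_mult using nonneg by (intro mult_mono A r that vX) auto
  from sum_le[OF this] show "\<bar>(A *\<^sub>v v + b) $ r\<bar> \<le> R * w * X"
    using nonneg r by (simp add: affine_index[OF dims(1,2,5)] mult_ac)
  have "\<bar>coef (A', b') r c * ?v' c\<bar> \<le> R * X" if "c \<le> n" for c
    unfolding abs_mult using nonneg by (intro mult_mono A' r that vX) auto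
  from sum_le[OF this] show "\<bar>(A' *\<^sub>v v' + b') $ r\<bar> \<le> R * w * X"
    using nonneg r by (simp add: affine_index[OF dims(3,4,6)] mult_ac)
  have "\<bar>coef (A, b) r c * ?v c - coef (A', b') r c * ?v' c\<bar> \<le> R * e + \<delta> * X" if "c \<le> n" for c
  proof -
    have "\<bar>coef (A, b) r c * ?v c - coef (A', b') r c * ?v' c\<bar>
        \<le> \<bar>coef (A, b) r c\<bar> * \<bar>?v c - ?v' c\<bar> + \<bar>coef (A, b) r c - coef (A', b') r c\<bar> * \<bar>?v' c\<bar>"
      by (rule abs_mult_diff_le)
    also have "\<dots> \<le> R * e + \<delta> * X"
      using nonneg by (intro add_mono mult_mono A close r that vX) auto
    finally show ?thesis .
  qed
  from sum_le[OF this] show "\<bar>(A *\<^sub>v v + b) $ r - (A' *\<^sub>v v' + b') $ r\<bar> \<le> w * (R * e + \<delta> * X)"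
    using nonneg by (simp add: affine_index[OF dims(1,2,5) r] affine_index[OF dims(3,4,6) r]
        sum_subtractf[symmetric] del: sum.atMost_Suc)
qed

text \<open>Each layer multiplies the size of the signal by at most \<open>R w\<close>.\<close>

lemma relu_net_perturbation:
  fixes v v' :: "real vec"
  assumes "\<theta> \<in> params_of l" "\<theta>' \<in> params_of l"
    and "coefs_bounded R \<theta>" "coefs_bounded R \<theta>'" "coefs_close \<delta> \<theta> \<theta>'"
    and "v \<in> carrier_vec (hd l)" "v' \<in> carrier_vec (hd l)"
    and "\<And>c. c < hd l \<Longrightarrow> \<bar>v $ c\<bar> \<le> X" "\<And>c. c < hd l \<Longrightarrow> \<bar>v' $ c\<bar> \<le> X"
    and "\<And>c. c < hd l \<Longrightarrow> \<bar>v $ c - v' $ c\<bar> \<le> e"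
    and "\<And>n. n \<in> set l \<Longrightarrow> real n + 1 \<le> w"
    and "1 \<le> R" "1 \<le> w" "1 \<le> X" "0 \<le> e" "0 \<le> \<delta>" "r < last l"
  shows "\<bar>relu_net \<theta> v $ r - relu_net \<theta>' v' $ r\<bar>
    \<le> (R * w) ^ length \<theta> * (e + real (length \<theta>) * \<delta> * X)"
  using assms
proof (induction \<theta> v arbitrary: l \<theta>' v' X e rule: relu_net.induct)
  case (1 v)
  then show ?case by (auto simp: params_of_Nil coefs_close_def)
next
  case (2 A b v)
  from "2.prems"(5) obtain A' b' where \<theta>': "\<theta>' = [(A', b')]"
    by (auto simp: coefs_close_def list_all2_Cons1)
  from "2.prems"(1,2) obtain n m where l: "l = [n, m]" "A \<in> carrier_mat m n" "b \<in> carrier_vec m"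
      "A' \<in> carrier_mat m n" "b' \<in> carrier_vec m"
    unfolding \<theta>' by (auto simp: params_of_Cons params_of_Nil)
  note prems = "2.prems"
  have vc: "v \<in> carrier_vec n" "v' \<in> carrier_vec n" using prems(6,7) l(1) by auto
  have bds: "\<bar>coef (A, b) r c\<bar> \<le> R" "\<bar>coef (A', b') r c\<bar> \<le> R"
      "\<bar>coef (A, b) r c - coef (A', b') r c\<bar> \<le> \<delta>" if "r < m" "c \<le> n" for r c
    using prems(3,4,5) l that by (auto simp: coefs_bounded_def coefs_close_def \<theta>')
  have vb: "\<bar>v $ c\<bar> \<le> X" "\<bar>v' $ c\<bar> \<le> X" "\<bar>v $ c - v' $ c\<bar> \<le> e" if "c < n" for c
    using prems(8,9,10) l(1) that by auto
  have R0: "0 \<le> R" and n: "real n + 1 \<le> w" and r: "r < m" using prems(11,12,17) l(1) by auto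
  have "\<bar>(A *\<^sub>v v + b) $ r - (A' *\<^sub>v v' + b') $ r\<bar> \<le> w * (R * e + \<delta> * X)"
    by (rule affine_perturbation(3)[OF l(2-5) vc bds(1) bds(2) bds(3) vb(1) vb(2) vb(3) R0
      \<open>1 \<le> X\<close> \<open>0 \<le> e\<close> \<open>0 \<le> \<delta>\<close> n r])
  \<comment> \<open>A factor \<open>R \<ge> 1\<close> is spent on the weight error too, so that both
    errors carry \<open>R * w\<close>.\<close>
  also have "\<dots> \<le> (R * w) * (e + \<delta> * X)"
  proof -
    have "0 \<le> w * (\<delta> * X)" using prems(12-16) by auto
    then have "1 * (w * (\<delta> * X)) \<le> R * (w * (\<delta> * X))" using prems(12) by (intro mult_right_mono) auto
    then show ?thesis by (simp add: algebra_simps)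
  qed
  finally show ?case by (simp add: \<theta>')
next
  case (3 A b p \<theta> v)
  note prems = "3.prems"
  from prems(5) obtain A' b' p' \<theta>'' where \<theta>': "\<theta>' = (A', b') # p' # \<theta>''"
      and close: "coefs_close \<delta> (p # \<theta>) (p' # \<theta>'')"
    by (auto simp: coefs_close_def list_all2_Cons1)
  from prems(1,2) obtain n m ls where l: "l = n # m # ls" "A \<in> carrier_mat m n" "b \<in> carrier_vec m"
      "A' \<in> carrier_mat m n" "b' \<in> carrier_vec m"
      and tl: "p # \<theta> \<in> params_of (m # ls)" "p' # \<theta>'' \<in> params_of (m # ls)"
    unfolding \<theta>' params_of_Cons by auto
  have vc: "v \<in> carrier_vec n" "v' \<in> carrier_vec n" using prems(6,7) l(1) by auto
  have bds: "\<bar>coef (A, b) r c\<bar> \<le> R" "\<bar>coef (A', b') r c\<bar> \<le> R"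
      "\<bar>coef (A, b) r c - coef (A', b') r c\<bar> \<le> \<delta>" if "r < m" "c \<le> n" for r c
    using prems(3,4,5) l that by (auto simp: coefs_bounded_def coefs_close_def \<theta>')
  have vb: "\<bar>v $ c\<bar> \<le> X" "\<bar>v' $ c\<bar> \<le> X" "\<bar>v $ c - v' $ c\<bar> \<le> e" if "c < n" for c
    using prems(8,9,10) l(1) that by auto
  have R0: "0 \<le> R" and n: "real n + 1 \<le> w" using prems(11,12) l(1) by auto
  note aff = affine_perturbation[OF l(2-5) vc bds(1) bds(2) bds(3) vb(1) vb(2) vb(3) R0
      \<open>1 \<le> X\<close> \<open>0 \<le> e\<close> \<open>0 \<le> \<delta>\<close> n]
  \<comment> \<open>ReLU is 1-Lipschitz and fixes 0, so the affine bounds survive the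
    activation.\<close>
  have max: "\<bar>max x 0\<bar> \<le> \<bar>x\<bar>" "\<bar>max x 0 - max y 0\<bar> \<le> \<bar>x - y\<bar>" for x y :: real
    by (auto simp: max_def abs_if)
  have relu_nth: "relu (A *\<^sub>v v + b) $ r = max ((A *\<^sub>v v + b) $ r) 0"
    "relu (A' *\<^sub>v v' + b') $ r = max ((A' *\<^sub>v v' + b') $ r) 0" if "r < m" for r
    using l that by (auto simp: relu_def)
  have relu: "\<bar>relu (A *\<^sub>v v + b) $ r\<bar> \<le> R * w * X" "\<bar>relu (A' *\<^sub>v v' + b') $ r\<bar> \<le> R * w * X"
      "\<bar>relu (A *\<^sub>v v + b) $ r - relu (A' *\<^sub>v v' + b') $ r\<bar> \<le> w * (R * e + \<delta> * X)" if "r < m" for r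
    unfolding relu_nth[OF that] by (rule order_trans[OF max(1)] order_trans[OF max(2)], rule aff, (assumption | rule that)+)+
  have relu': "\<bar>relu (A *\<^sub>v v + b) $ r\<bar> \<le> R * w * X" "\<bar>relu (A' *\<^sub>v v' + b') $ r\<bar> \<le> R * w * X"
      "\<bar>relu (A *\<^sub>v v + b) $ r - relu (A' *\<^sub>v v' + b') $ r\<bar> \<le> w * (R * e + \<delta> * X)"
      if "r < hd (m # ls)" for r
    using relu[of r] that by auto
  let ?k = "length (p # \<theta>)"
  have cb: "coefs_bounded R (p # \<theta>)" "coefs_bounded R (p' # \<theta>'')"
    using prems(3,4) by (auto simp: coefs_bounded_def \<theta>')
  have carrier: "relu (A *\<^sub>v v + b) \<in> carrier_vec (hd (m # ls))"
    "relu (A' *\<^sub>v v' + b') \<in> carrier_vec (hd (m # ls))"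
    unfolding carrier_vec_def using l(3,5) by simp_all
  have w: "real i + 1 \<le> w" if "i \<in> set (m # ls)" for i
    using prems(11) l(1) that by auto
  have X: "1 \<le> R * w * X"
    using mult_mono[OF mult_mono[of 1 R 1 w] prems(14)] prems(12,13) by simp
  have e: "0 \<le> w * (R * e + \<delta> * X)"
    using prems(12-16) by (intro mult_nonneg_nonneg add_nonneg_nonneg) auto
  have r: "r < last (m # ls)" using prems(17) l(1) by simp
  have "\<bar>relu_net (p # \<theta>) (relu (A *\<^sub>v v + b)) $ r - relu_net (p' # \<theta>'') (relu (A' *\<^sub>v v' + b')) $ r\<bar>
      \<le> (R * w) ^ ?k * (w * (R * e + \<delta> * X) + real ?k * \<delta> * (R * w * X))"
    by (rule "3.IH"[OF tl cb close carrier relu' w prems(12,13) X e prems(16) r])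
  also have "\<dots> \<le> (R * w) ^ ?k * ((R * w) * (e + \<delta> * X) + real ?k * \<delta> * (R * w * X))"
  proof (intro mult_left_mono add_right_mono)
    have "0 \<le> w * (\<delta> * X)" using prems(12-16) by auto
    then have "1 * (w * (\<delta> * X)) \<le> R * (w * (\<delta> * X))" using prems(12) by (intro mult_right_mono) auto
    then show "w * (R * e + \<delta> * X) \<le> (R * w) * (e + \<delta> * X)" by (simp add: algebra_simps)
  qed (use prems(12,13) in auto)
  \<comment> \<open>Taking out one \<open>R * w\<close> leaves \<open>e + \<delta> * X\<close>, and
    this \<open>\<delta> * X\<close> raises the layer count in the linear term by one.\<close>
  also have "\<dots> = (R * w) ^ length ((A, b) # p # \<theta>)
      * (e + real (length ((A, b) # p # \<theta>)) * \<delta> * X)"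
    by (simp add: algebra_simps)
  finally show ?case by (simp add: \<theta>')
qed

section \<open>Measurability of the network output\<close>

text \<open>The input map \<open>g\<close> is arbitrary for the sake of the induction: the remaining
  layers see the output of the first one instead of the original input.\<close>

lemma relu_net_measurable:
  fixes g :: "'a \<Rightarrow> real vec"
  assumes "\<theta> \<in> params_of l" "\<And>y. g y \<in> carrier_vec (hd l)"
    and "\<And>c. c < hd l \<Longrightarrow> (\<lambda>y. g y $ c) \<in> borel_measurable M" and "r < last l"
  shows "(\<lambda>y. relu_net \<theta> (g y) $ r) \<in> borel_measurable M"
  using assms
proof (induction \<theta> arbitrary: l g)
  case Nil
  then show ?case by (auto simp: params_of_Nil)
next
  case (Cons p \<theta>)
  obtain A b where p: "p = (A, b)" by (cases p)
  from Cons.prems(1) obtain n m ls where l: "l = n # m # ls" "A \<in> carrier_mat m n"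
    "b \<in> carrier_vec m" "\<theta> \<in> params_of (m # ls)" unfolding p params_of_Cons by auto
  have aff: "(\<lambda>y. (A *\<^sub>v g y + b) $ r) \<in> borel_measurable M" if "r < m" for r
  proof -
    have "(\<lambda>y. (A *\<^sub>v g y + b) $ r) = (\<lambda>y. \<Sum>c\<le>n. coef (A, b) r c * (if c < n then g y $ c else 1))"
      using Cons.prems(2) l that by (intro ext affine_index) auto
    moreover have "(\<lambda>y. if c < n then g y $ c else 1) \<in> borel_measurable M" for c
      using Cons.prems(3) l by (cases "c < n") auto
    ultimately show ?thesis by simp
  qed
  show ?case
  proof (cases \<theta>)
    case Nil
    then show ?thesis using aff Cons.prems(4) l by (auto simp: p params_of_Nil)
  next
    case (Cons q \<theta>')
    have "(\<lambda>y. relu_net \<theta> (relu (A *\<^sub>v g y + b)) $ r) \<in> borel_measurable M"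
    proof (rule Cons.IH[OF l(4)])
      fix c assume c: "c < hd (m # ls)"
      have "(\<lambda>y. relu (A *\<^sub>v g y + b) $ c) = (\<lambda>y. max ((A *\<^sub>v g y + b) $ c) 0)"
        using c l by (auto simp: relu_def)
      then show "(\<lambda>y. relu (A *\<^sub>v g y + b) $ c) \<in> borel_measurable M"
        using aff c by simp
    next
      show "relu (A *\<^sub>v g y + b) \<in> carrier_vec (hd (m # ls))" for y
        unfolding carrier_vec_def using l(3) by simp
      show "r < last (m # ls)" using Cons.prems(4) l(1) by simp
    qed
    then show ?thesis by (simp add: p Cons)
  qed
qed

section \<open>Covering the parameter space\<close>

lemma weight_magnitude_coefs_bounded:
  assumes \<theta>: "\<theta> \<in> params_of l" and R: "weight_magnitude \<theta> \<le> R"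
  shows "coefs_bounded R \<theta>"
  unfolding coefs_bounded_def
proof (intro ballI allI impI)
  fix p r c assume p: "p \<in> set \<theta>" and r: "r < dim_row (fst p)" and c: "c \<le> dim_col (fst p)"
  let ?S = "\<Union>(A, b)\<in>set \<theta>. abs ` (elements_mat A \<union> vec_set b)"
  obtain A b where Ab: "p = (A, b)" by (cases p)
  have dim: "dim_vec b = dim_row A"
    using \<theta> p by (fastforce simp: params_of_def Ab in_set_conv_nth)
  have "coef p r c \<in> elements_mat A \<union> vec_set b"
    using r c by (auto simp: Ab coef_def dim intro: vec_setI)
  then have "\<bar>coef p r c\<bar> \<in> ?S" using p Ab by auto
  moreover have "finite ?S" by (auto simp: elements_mat_def vec_set_def)
  ultimately have "\<bar>coef p r c\<bar> \<le> weight_magnitude \<theta>"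
    unfolding weight_magnitude_def by (intro Max_ge)
  then show "\<bar>coef p r c\<bar> \<le> R" using R by simp
qed

lemma width_le_max_width:
  assumes \<theta>: "\<theta> \<in> params_of l" and l: "architecture l" and n: "n \<in> set l"
  shows "n \<le> max_width \<theta>"
proof -
  let ?S = "\<Union>(A, b)\<in>set \<theta>. {dim_row A, dim_col A}"
  have len: "Suc (length \<theta>) = length l" and len0: "0 < length \<theta>"
    using \<theta> l by (auto simp: params_of_def architecture_def)
  have dims: "dim_row (fst (\<theta> ! i)) = l ! Suc i" "dim_col (fst (\<theta> ! i)) = l ! i" if "i < length \<theta>" for i
    using \<theta> that by (fastforce simp: params_of_def)+
  obtain i where i: "i < length l" "n = l ! i" using n by (auto simp: in_set_conv_nth)
  have "n \<in> ?S"
  \<comment> \<open>The width at a position \<open>i < length \<theta>\<close> is the column count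
    of layer \<open>i\<close>; the final width is the row count of the last layer.\<close>
  proof (cases "i < length \<theta>")
    case True
    then have "\<theta> ! i \<in> set \<theta>" "n = dim_col (fst (\<theta> ! i))" using dims i by auto
    then show ?thesis by (force simp: case_prod_beta)
  next
    case False
    then have "i = Suc (length \<theta> - 1)" using i len len0 by simp
    then have "\<theta> ! (length \<theta> - 1) \<in> set \<theta>" "n = dim_row (fst (\<theta> ! (length \<theta> - 1)))"
      using dims[of "length \<theta> - 1"] i len0 by auto
    then show ?thesis by (force simp: case_prod_beta)
  qed
  moreover have "finite ?S" by auto
  ultimately show ?thesis unfolding max_width_def by (intro Max_ge)
qed

lemma num_params_le:
  assumes "\<And>n. n \<in> set l \<Longrightarrow> n \<le> W" "length l - 1 \<le> L"
  shows "num_params l \<le> L * (W * W + W)"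
proof -
  have "num_params l \<le> (\<Sum>i<length l - 1. W * W + W)"
    unfolding num_params_def using assms by (intro sum_mono add_mono mult_mono) auto
  also have "\<dots> \<le> L * (W * W + W)" using assms by (simp add: mult_right_mono del: add_mult_distrib2)
  finally show ?thesis .
qed

section \<open>Rounding the weights to a grid\<close>

text \<open>Layer, row and column of \<open>coef\<close>. The column range is closed because
  \<open>c = l ! i\<close> is the bias, so there is one index per network parameter.\<close>

definition coef_indices :: "nat list \<Rightarrow> (nat \<times> nat \<times> nat) set" where
  "coef_indices l = (SIGMA i:{..<length l - 1}. {..<l ! Suc i} \<times> {..l ! i})"

lemma coef_indices: "finite (coef_indices l)" "card (coef_indices l) = num_params l"
  by (simp_all add: coef_indices_def num_params_def card_cartesian_product add.commute)

lemma coefs_closeI: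
  assumes "\<theta> \<in> params_of l" "\<theta>' \<in> params_of l"
    and "\<And>i r c. (i, r, c) \<in> coef_indices l \<Longrightarrow> \<bar>coef (\<theta> ! i) r c - coef (\<theta>' ! i) r c\<bar> \<le> \<delta>"
  shows "coefs_close \<delta> \<theta> \<theta>'"
  unfolding coefs_close_def list_all2_conv_all_nth
proof (intro conjI allI impI)
  show "length \<theta> = length \<theta>'" using assms by (auto simp: params_of_def)
  fix i r c assume i: "i < length \<theta>" and r: "r < dim_row (fst (\<theta> ! i))" and c: "c \<le> dim_col (fst (\<theta> ! i))"
  have "dim_row (fst (\<theta> ! i)) = l ! Suc i" "dim_col (fst (\<theta> ! i)) = l ! i" "length \<theta> = length l - 1"
    using assms(1) i by (fastforce simp: params_of_def)+
  then show "\<bar>coef (\<theta> ! i) r c - coef (\<theta>' ! i) r c\<bar> \<le> \<delta>"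
    using i r c by (intro assms(3)) (auto simp: coef_indices_def)
qed

lemma coefs_boundedD:
  assumes "\<theta> \<in> params_of l" "coefs_bounded R \<theta>" "(i, r, c) \<in> coef_indices l"
  shows "\<bar>coef (\<theta> ! i) r c\<bar> \<le> R"
proof -
  have i: "i < length \<theta>" using assms(1,3) by (auto simp: params_of_def coef_indices_def)
  have "dim_row (fst (\<theta> ! i)) = l ! Suc i" "dim_col (fst (\<theta> ! i)) = l ! i"
    using assms(1) i by (fastforce simp: params_of_def)+
  then show ?thesis
    using assms(2,3) i by (auto simp: coefs_bounded_def coef_indices_def)
qed

text \<open>Each weight is rescaled from \<open>[-R, R]\<close> to \<open>[0, P]\<close> and rounded
  down, and one element of \<Theta> is kept for each rounding pattern that occurs. Parameters with
  the same pattern differ by at most one grid step, and centres taken from \<Theta> inherit its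
  properties, later the clipping.\<close>

lemma params_cover:
  assumes \<Theta>: "\<Theta> \<subseteq> params_of l" "\<And>\<theta>. \<theta> \<in> \<Theta> \<Longrightarrow> coefs_bounded R \<theta>"
    and R: "0 < R" and P: "0 < P"
  obtains N where "N \<subseteq> \<Theta>" "finite N" "card N \<le> (P + 1) ^ num_params l"
    "\<And>\<theta>. \<theta> \<in> \<Theta> \<Longrightarrow> \<exists>\<theta>'\<in>N. coefs_close (2 * R / real P) \<theta> \<theta>'"
proof -
  define x where "x \<theta> = (\<lambda>(i, r, c). (coef (\<theta> ! i) r c + R) * real P / (2 * R))" for \<theta>
  define q where "q \<theta> = (\<lambda>z\<in>coef_indices l. nat \<lfloor>x \<theta> z\<rfloor>)" for \<theta>
  have x: "0 \<le> x \<theta> z \<and> x \<theta> z \<le> real P" if "\<theta> \<in> \<Theta>" "z \<in> coef_indices l" for \<theta> z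
  proof -
    obtain i r c where z: "z = (i, r, c)" by (cases z)
    have "\<bar>coef (\<theta> ! i) r c\<bar> \<le> R"
      using coefs_boundedD \<Theta> that z by blast
    then have "0 \<le> coef (\<theta> ! i) r c + R" "coef (\<theta> ! i) r c + R \<le> 2 * R" by auto
    then have "0 \<le> (coef (\<theta> ! i) r c + R) * real P" "(coef (\<theta> ! i) r c + R) * real P \<le> (2 * R) * real P"
      by (auto intro!: mult_nonneg_nonneg mult_right_mono)
    then show ?thesis
      using R by (simp add: x_def z pos_divide_le_eq mult_ac)
  qed
  have q: "q ` \<Theta> \<subseteq> coef_indices l \<rightarrow>\<^sub>E {..P}"
  proof (intro image_subsetI PiE_I)
    fix \<theta> z assume "\<theta> \<in> \<Theta>" "z \<in> coef_indices l"
    with x[OF this] have "\<lfloor>x \<theta> z\<rfloor> \<le> int P" by (simp add: floor_le_iff)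
    with \<open>z \<in> coef_indices l\<close> show "q \<theta> z \<in> {..P}" by (simp add: q_def nat_le_iff)
  qed (simp add: q_def)
  have fin: "finite (coef_indices l \<rightarrow>\<^sub>E {..P})" by (intro finite_PiE coef_indices) auto
  let ?N = "inv_into \<Theta> q ` q ` \<Theta>"
  show ?thesis
  proof
    show "?N \<subseteq> \<Theta>" by (auto intro: inv_into_into)
    show "finite ?N" using q fin by (auto intro: finite_subset)
    have "card ?N \<le> card (q ` \<Theta>)" using q fin by (intro card_image_le) (auto intro: finite_subset)
    also have "\<dots> \<le> card (coef_indices l \<rightarrow>\<^sub>E {..P})" using q fin by (intro card_mono)
    also have "\<dots> = (P + 1) ^ num_params l"
      by (simp add: card_PiE coef_indices)
    finally show "card ?N \<le> (P + 1) ^ num_params l" .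
  next
    fix \<theta> assume \<theta>: "\<theta> \<in> \<Theta>"
    define \<theta>' where "\<theta>' = inv_into \<Theta> q (q \<theta>)"
    have \<theta>': "\<theta>' \<in> \<Theta>" "q \<theta>' = q \<theta>"
      using \<theta> by (auto simp: \<theta>'_def inv_into_into f_inv_into_f)
    have "coefs_close (2 * R / real P) \<theta> \<theta>'"
    proof (rule coefs_closeI[of _ l])
      fix i r c assume z: "(i, r, c) \<in> coef_indices l"
      have "nat \<lfloor>x \<theta> (i, r, c)\<rfloor> = nat \<lfloor>x \<theta>' (i, r, c)\<rfloor>"
        using fun_cong[OF \<theta>'(2), of "(i, r, c)"] z by (simp add: q_def)
      \<comment> \<open>Both values are nonnegative, so \<open>nat\<close> loses nothing: the floors
        agree.\<close>
      then have "\<bar>x \<theta> (i, r, c) - x \<theta>' (i, r, c)\<bar> \<le> 1"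
        using x[OF \<theta> z] x[OF \<theta>'(1) z] by linarith
      moreover have "coef (\<theta> ! i) r c - coef (\<theta>' ! i) r c
          = (x \<theta> (i, r, c) - x \<theta>' (i, r, c)) * (2 * R / real P)"
        using R P by (simp add: x_def field_simps)
      ultimately show "\<bar>coef (\<theta> ! i) r c - coef (\<theta>' ! i) r c\<bar> \<le> 2 * R / real P"
        using R P mult_right_mono[of "\<bar>x \<theta> (i, r, c) - x \<theta>' (i, r, c)\<bar>" 1 "2 * R / real P"]
        by (simp add: abs_mult)
    qed (use \<Theta>(1) \<theta> \<theta>' in auto)
    then show "\<exists>\<theta>'\<in>?N. coefs_close (2 * R / real P) \<theta> \<theta>'"
      using \<theta> by (auto simp: \<theta>'_def)
  qed
qed

text \<open>Both networks get the same input of size at most 1, so the perturbation bound is taken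
  with \<open>e = 0\<close> and \<open>X = 1\<close>; the depth is then raised to \<open>L\<close>,
  which only increases the bound since \<open>1 \<le> R * (real W + 1)\<close>.\<close>

lemma net_cover:
  fixes \<Theta> :: "params set"
  assumes \<Theta>: "\<Theta> \<subseteq> params_of l" "\<And>\<theta>. \<theta> \<in> \<Theta> \<Longrightarrow> weight_magnitude \<theta> \<le> R"
    and R: "1 \<le> R" and P: "0 < P" and W: "\<And>n. n \<in> set l \<Longrightarrow> n \<le> W" and L: "length l - 1 \<le> L"
  obtains N where "N \<subseteq> \<Theta>" "finite N" "card N \<le> (P + 1) ^ num_params l"
    "\<And>\<theta>. \<theta> \<in> \<Theta> \<Longrightarrow> \<exists>\<theta>'\<in>N. \<forall>v\<in>carrier_vec (hd l). (\<forall>c<hd l. \<bar>v $ c\<bar> \<le> 1) \<longrightarrow>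
       (\<forall>r<last l. \<bar>relu_net \<theta> v $ r - relu_net \<theta>' v $ r\<bar>
         \<le> (R * (real W + 1)) ^ L * (real L * (2 * R / real P)))"
proof -
  have bounded: "coefs_bounded R \<theta>" if "\<theta> \<in> \<Theta>" for \<theta>
    using weight_magnitude_coefs_bounded \<Theta> that by blast
  have R0: "0 < R" using R by simp
  obtain N where N: "N \<subseteq> \<Theta>" "finite N"
    "card N \<le> (P + 1) ^ num_params l" "\<And>\<theta>. \<theta> \<in> \<Theta> \<Longrightarrow> \<exists>\<theta>'\<in>N. coefs_close (2 * R / real P) \<theta> \<theta>'"
    using params_cover[OF \<Theta>(1) bounded R0 P] by blast
  show ?thesis
  proof (rule that[OF N(1-3)])
    fix \<theta> assume \<theta>: "\<theta> \<in> \<Theta>"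
    then obtain \<theta>' where \<theta>': "\<theta>' \<in> N" "coefs_close (2 * R / real P) \<theta> \<theta>'" using N(4) by blast
    have "\<bar>relu_net \<theta> v $ r - relu_net \<theta>' v $ r\<bar>
         \<le> (R * (real W + 1)) ^ L * (real L * (2 * R / real P))"
      if v: "v \<in> carrier_vec (hd l)" "\<forall>c<hd l. \<bar>v $ c\<bar> \<le> 1" and r: "r < last l" for v r
    proof -
      have "\<bar>relu_net \<theta> v $ r - relu_net \<theta>' v $ r\<bar>
         \<le> (R * (real W + 1)) ^ length \<theta> * (0 + real (length \<theta>) * (2 * R / real P) * 1)"
        by (rule relu_net_perturbation[where l=l])
          (use \<theta> \<theta>' N(1) \<Theta>(1) bounded v r R W in auto)
      also have "\<dots> = (R * (real W + 1)) ^ length \<theta> * (real (length \<theta>) * (2 * R / real P))"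
        by simp
      also have "\<dots> \<le> (R * (real W + 1)) ^ L * (real L * (2 * R / real P))"
      proof (intro mult_mono power_increasing)
        show "length \<theta> \<le> L" "real (length \<theta>) \<le> real L"
          using \<theta> \<Theta>(1) L by (auto simp: params_of_def)
        show "1 \<le> R * (real W + 1)"
          using mult_mono[of 1 R 1 "real W + 1"] R by simp
      qed (use R in auto)
      finally show ?thesis .
    qed
    with \<theta>'(1) show "\<exists>\<theta>'\<in>N. \<forall>v\<in>carrier_vec (hd l). (\<forall>c<hd l. \<bar>v $ c\<bar> \<le> 1) \<longrightarrow>
       (\<forall>r<last l. \<bar>relu_net \<theta> v $ r - relu_net \<theta>' v $ r\<bar>
         \<le> (R * (real W + 1)) ^ L * (real L * (2 * R / real P)))"
      by blast
  qed
qed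

text \<open>\<open>P\<close> is chosen just large enough for a mesh of at most
  \<open>1 / (2 * real M)\<close>. It is exponential in \<open>L\<close>, but only its logarithm
  matters, and there everything is absorbed into \<open>ln (2 * real M * R)\<close> at the cost of
  factors \<open>L\<close> and \<open>W + 1\<close>.\<close>

lemma cover_numerics:
  fixes R :: real and W L M k :: nat
  assumes R: "1 \<le> R" and W: "0 < W" and L: "0 < L" and M: "0 < M" and k: "k \<le> L * (W * W + W)"
  defines "P \<equiv> nat \<lceil>4 * R * real L * (R * (real W + 1)) ^ L * real M\<rceil>"
  shows "0 < P"
    and "(R * (real W + 1)) ^ L * (real L * (2 * R / real P)) \<le> 1 / (2 * real M)"
    and "real k * ln (real P + 1) \<le> 7 * (real L)\<^sup>2 * (real W + 1) ^ 4 * ln (2 * real M * R)"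
proof -
  let ?B = "R * (real W + 1)" and ?l = "ln (2 * real M * R)"
  define y where "y = 4 * R * real L * ?B ^ L * real M"
  have B: "1 \<le> ?B" using mult_mono[of 1 R 1 "real W + 1"] R by simp
  have "1 \<le> R * real L" "1 \<le> ?B ^ L * real M"
    using mult_mono[of 1 R 1 "real L"] mult_mono[of 1 "?B ^ L" 1 "real M"] one_le_power[OF B] R L M by auto
  then have "1 \<le> (R * real L) * (?B ^ L * real M)"
    using mult_mono[of 1 "R * real L" 1 "?B ^ L * real M"] by simp
  then have y: "4 \<le> y" by (simp add: y_def mult_ac)
  have P: "y \<le> real P" "real P \<le> y + 1"
    using y unfolding P_def y_def[symmetric] by linarith+
  show P0: "0 < P" using P y by simp
  have "?B ^ L * (real L * (2 * R)) = y / (2 * real M)"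
    using M by (simp add: y_def)
  also have "\<dots> \<le> real P / (2 * real M)" using P M by (intro divide_right_mono) auto
  finally show "?B ^ L * (real L * (2 * R / real P)) \<le> 1 / (2 * real M)"
    using P0 M by (simp add: field_simps)
  have lnR: "0 \<le> ln R" and lnM: "0 \<le> ln (real M)" using R M by auto
  have l: "?l = ln 2 + ln (real M) + ln R" using R M by (simp add: ln_mult)
  \<comment> \<open>This yields \<open>1 \<le> 2 * ?l\<close>, which absorbs the terms in
    \<open>L\<close> and \<open>W\<close> alone.\<close>
  have l23: "2 / 3 \<le> ?l" using ln2_ge_two_thirds l lnR lnM by linarith
  have l0: "0 \<le> ?l" using l23 by linarith
  have ln8: "ln (8::real) = 3 * ln 2" using ln_realpow[of 2 3] by simp
  \<comment> \<open>\<open>P + 1 \<le> y + 2 \<le> 2 * y\<close>, since \<open>y\<close> is at least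
    4.\<close>
  have "ln (real P + 1) \<le> ln (2 * y)" using P y by (intro ln_mono) auto
  also have "2 * y = 2 ^ 3 * R * real L * ?B ^ L * real M" by (simp add: y_def)
  also have "ln \<dots> = 3 * ln 2 + ln R + ln (real L) + real L * (ln R + ln (real W + 1)) + ln (real M)"
    using R L M B by (simp add: ln_mult ln_realpow ln8)
  \<comment> \<open>The four summands take up, in order: \<open>3 * ln 2\<close>;
    \<open>ln R + ln M\<close> with \<open>L * ln R\<close>; \<open>ln L\<close>; and
    \<open>L * ln (W + 1)\<close>. The later 7 is \<open>3 + 2 + 2\<close>.\<close>
  also have "\<dots> \<le> 3 * ?l * real L + 2 * ?l * real L + 2 * ?l * real L + real L * (2 * ?l * real W)"
  proof -
    have L1: "1 \<le> real L" using L by simp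
    have a: "3 * ln 2 \<le> 3 * ?l * real L"
      using mult_mono[of "3 * ln 2" "3 * ?l" 1 "real L"] l lnR lnM L1 l0 by simp
    have "ln R + ln (real M) \<le> ?l" using l ln2_ge_two_thirds by linarith
    also have "\<dots> \<le> ?l * real L" using mult_left_mono[OF L1 l0] by simp
    finally have b: "ln R + ln (real M) \<le> ?l * real L" .
    have c: "real L * ln R \<le> ?l * real L"
      using mult_left_mono[of "ln R" ?l "real L"] l lnM ln2_ge_two_thirds by (simp add: mult.commute)
    have "ln (real L) \<le> real L" using ln_le_minus_one[of "real L"] L by simp
    also have "\<dots> \<le> 2 * ?l * real L"
      using mult_right_mono[of 1 "2 * ?l" "real L"] l23 by simp
    finally have d: "ln (real L) \<le> 2 * ?l * real L" .
    have "ln (real W + 1) \<le> real W" using ln_le_minus_one[of "real W + 1"] by simp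
    also have "\<dots> \<le> 2 * ?l * real W"
      using mult_right_mono[of 1 "2 * ?l" "real W"] l23 by simp
    finally have e: "real L * ln (real W + 1) \<le> real L * (2 * ?l * real W)"
      by (intro mult_left_mono) auto
    show ?thesis using a b c d e by (simp only: distrib_left)
  qed
  also have "\<dots> \<le> 7 * real L * ?l * (real W + 1)"
    using l0 by (simp add: algebra_simps)
  finally have ln: "ln (real P + 1) \<le> 7 * real L * ?l * (real W + 1)" .
  have "real k \<le> real (L * (W * W + W))" using k by (simp only: of_nat_le_iff)
  also have "\<dots> = real L * (real W * (real W + 1))" by (simp add: algebra_simps)
  \<comment> \<open>Relaxed to a cube: with the factor \<open>W + 1\<close> from the logarithm this
    becomes a fourth power, whose root is the \<open>(W + 1)\<^sup>2\<close> of the final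
    estimate.\<close>
  also have "\<dots> \<le> real L * ((real W + 1)\<^sup>2 * (real W + 1))"
    by (intro mult_left_mono mult_right_mono) (auto simp: power2_eq_square algebra_simps)
  finally have k: "real k \<le> real L * ((real W + 1)\<^sup>2 * (real W + 1))" .
  have "real k * ln (real P + 1) \<le> (real L * ((real W + 1)\<^sup>2 * (real W + 1))) * (7 * real L * ?l * (real W + 1))"
    by (rule mult_mono[OF k ln]) auto
  also have "\<dots> = 7 * (real L)\<^sup>2 * (real W + 1) ^ 4 * ?l"
    by (simp add: power2_eq_square power4_eq_xxxx mult_ac)
  finally show "real k * ln (real P + 1) \<le> 7 * (real L)\<^sup>2 * (real W + 1) ^ 4 * ?l" .
qed

section \<open>The loss as a random variable\<close>

text \<open>Consecutive half-open cells share an endpoint, so they glue together without overlap.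
  The start is \<open>a\<close> because \<open>grid a b J 0 = a\<close>, even for
  \<open>J = 0\<close>.\<close>

lemma sum_indicator_cells:
  assumes "a \<le> b"
  shows "(\<Sum>j = 1..n. indicator (cell a b J j) x) = (indicator {a..<grid a b J n} x :: real)"
proof (induction n)
  case 0
  then show ?case by (simp add: grid_def)
next
  case (Suc n)
  have "a \<le> grid a b J n" "grid a b J n \<le> grid a b J (Suc n)"
    using assms by (auto simp: grid_def intro!: divide_right_mono mult_right_mono)
  then show ?case
    using Suc.IH by (auto simp: cell_def indicator_def)
qed

text \<open>At most one cell contains \<open>x\<close>, so a uniform bound on the entries carries
  over without a factor \<open>J\<close>.\<close>

lemma net_solution_diff_le:
  assumes ab: "a \<le> b" and e: "0 \<le> e"
    and le: "\<And>j. j < J \<Longrightarrow> \<bar>relu_net \<theta> (vec d y) $ j - relu_net \<theta>' (vec d y) $ j\<bar> \<le> e"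
  shows "\<bar>net_solution a b d J \<theta> x y - net_solution a b d J \<theta>' x y\<bar> \<le> e"
proof -
  let ?r = "\<lambda>j. relu_net \<theta> (vec d y) $ (j - 1) - relu_net \<theta>' (vec d y) $ (j - 1)"
  have "net_solution a b d J \<theta> x y - net_solution a b d J \<theta>' x y
      = (\<Sum>j = 1..J. indicator (cell a b J j) x * ?r j)"
    by (simp add: net_solution_def sum_subtractf right_diff_distrib)
  also have "\<bar>\<dots>\<bar> \<le> (\<Sum>j = 1..J. indicator (cell a b J j) x * e)"
  proof (intro order_trans[OF sum_abs] sum_mono)
    fix j assume "j \<in> {1..J}"
    then have "\<bar>?r j\<bar> \<le> e" by (intro le) auto
    then show "\<bar>indicator (cell a b J j) x * ?r j\<bar> \<le> indicator (cell a b J j) x * e"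
      by (auto simp: indicator_def)
  qed
  also have "\<dots> = indicator {a..<grid a b J J} x * e"
    unfolding sum_distrib_right[symmetric] sum_indicator_cells[OF ab] ..
  also have "\<dots> \<le> e" using e by (auto simp: indicator_def)
  finally show ?thesis .
qed

lemma indicator_cell_measurable [measurable]:
  "(indicator (cell a b J j) :: real \<Rightarrow> real) \<in> borel_measurable (lebesgue_on S)"
  by (rule measurable_restrict_space1[OF measurable_completion]) (simp add: cell_def)

lemma integrable_net_solution:
  "integrable (lebesgue_on {a..b}) (\<lambda>x. net_solution a b d J \<theta> x y)"
proof -
  interpret finite_measure "lebesgue_on {a..b}"
    by (rule finite_measure_lebesgue_on) simp
  have "integrable (lebesgue_on {a..b}) (indicator (cell a b J j) :: real \<Rightarrow> real)" for j
    by (rule integrable_const_bound[where B=1]) (auto intro!: AE_I2 simp: indicator_def)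
  then show ?thesis
    unfolding net_solution_def
    by (intro Bochner_Integration.integrable_sum integrable_mult_left) auto
qed

section \<open>Comparison, integrability and measurability of the loss\<close>

text \<open>The reverse triangle inequality under the integral removes \<open>v\<close>. Two
  networks are thus compared by their outputs alone, whatever the size of the solution.\<close>

lemma L1_dist_diff_le:
  assumes ab: "a \<le> b"
    and v: "integrable (lebesgue_on {a..b}) v" and g: "integrable (lebesgue_on {a..b}) g"
    and h: "integrable (lebesgue_on {a..b}) h" and le: "\<And>x. \<bar>g x - h x\<bar> \<le> e"
  shows "\<bar>L1_dist a b v g - L1_dist a b v h\<bar> \<le> (b - a) * e"
proof -
  interpret finite_measure "lebesgue_on {a..b}"
    by (rule finite_measure_lebesgue_on) simp
  have "L1_dist a b v g - L1_dist a b v h = (LINT x|lebesgue_on {a..b}. \<bar>v x - g x\<bar> - \<bar>v x - h x\<bar>)"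
    unfolding L1_dist_def using v g h by (subst Bochner_Integration.integral_diff) auto
  also have "\<bar>\<dots>\<bar> \<le> (LINT x|lebesgue_on {a..b}. \<bar>\<bar>v x - g x\<bar> - \<bar>v x - h x\<bar>\<bar>)"
    by (rule integral_abs_bound)
  also have "\<dots> \<le> (LINT x|lebesgue_on {a..b}. e)"
  proof (intro integral_mono)
    show "\<bar>\<bar>v x - g x\<bar> - \<bar>v x - h x\<bar>\<bar> \<le> e" for x using le[of x] by linarith
  qed (use v g h in auto)
  also have "\<dots> = (b - a) * e"
    using ab by (simp add: measure_restrict_space)
  finally show ?thesis .
qed

text \<open>An essentially bounded function on a bounded interval is integrable. The bound
  \<open>K\<close> depends on the solution, hence on \<open>y\<close> in the application, so nothing
  uniform in \<open>y\<close> follows.\<close>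

lemma entropy_solution_integrable:
  assumes "entropy_solution T a b f u0 u" "0 < T"
  shows "integrable (lebesgue_on {a..b}) (u T)"
proof -
  interpret finite_measure "lebesgue_on {a..b}"
    by (rule finite_measure_lebesgue_on) simp
  obtain K where "AE x in lebesgue_on {a..b}. \<bar>u T x\<bar> \<le> K"
    using assms unfolding entropy_solution_def by (meson atLeastAtMost_iff less_imp_le order_refl)
  moreover have "u T \<in> borel_measurable (lebesgue_on {a..b})"
    using assms by (auto simp: entropy_solution_def)
  ultimately show ?thesis by (intro integrable_const_bound[where B=K]) auto
qed

lemma relu_net_measurable_unit_cube:
  fixes \<mu> :: "(nat \<Rightarrow> real) measure"
  assumes mu: "space \<mu> = unit_cube d" "sets (\<Pi>\<^sub>M i\<in>{..<d}. restrict_space borel {0..1}) \<subseteq> sets \<mu>"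
    and \<theta>: "\<theta> \<in> params_of l" "hd l = d" and r: "r < last l"
  shows "(\<lambda>y. relu_net \<theta> (vec d y) $ r) \<in> borel_measurable \<mu>"
proof (rule relu_net_measurable[OF \<theta>(1) _ _ r])
  let ?P = "\<Pi>\<^sub>M i\<in>{..<d}. restrict_space borel {0..1::real}"
  fix c assume "c < hd l"
  then have c: "c < d" using \<theta>(2) by simp
  have "(\<lambda>y. y c) \<in> measurable ?P (restrict_space borel {0..1})"
    using c by (intro measurable_component_singleton) auto
  then have "(\<lambda>y. y c) \<in> borel_measurable ?P"
    by (simp add: measurable_restrict_space2_iff)
  \<comment> \<open>The measurable sets of \<mu> may be more than the product Borel sets, so
    measurability is lifted from this subalgebra.\<close>
  moreover have "subalgebra \<mu> ?P"
    using mu by (simp add: subalgebra_def space_PiM space_restrict_space unit_cube_def)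
  ultimately have "(\<lambda>y. y c) \<in> borel_measurable \<mu>"
    by (metis measurable_from_subalg)
  then show "(\<lambda>y. vec d y $ c) \<in> borel_measurable \<mu>"
    using c by simp
qed (use \<theta>(2) in auto)

lemma L1_dist_net_measurable:
  fixes \<mu> :: "(nat \<Rightarrow> real) measure"
  assumes mu: "space \<mu> = unit_cube d" "sets (\<Pi>\<^sub>M i\<in>{..<d}. restrict_space borel {0..1}) \<subseteq> sets \<mu>"
    and \<theta>: "\<theta> \<in> params_of l" "hd l = d" "last l = J"
    and v: "(\<lambda>(x, y). v x y) \<in> borel_measurable (lebesgue_on {a..b} \<Otimes>\<^sub>M \<mu>)"
  shows "(\<lambda>y. L1_dist a b (\<lambda>x. v x y) (\<lambda>x. net_solution a b d J \<theta> x y)) \<in> borel_measurable \<mu>"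
proof -
  interpret finite_measure "lebesgue_on {a..b}"
    by (rule finite_measure_lebesgue_on) simp
  have v': "(\<lambda>p. v (snd p) (fst p)) \<in> borel_measurable (\<mu> \<Otimes>\<^sub>M lebesgue_on {a..b})"
    using measurable_compose[OF measurable_pair_swap' v] by (simp add: case_prod_beta)
  have "(\<lambda>p. net_solution a b d J \<theta> (snd p) (fst p)) \<in> borel_measurable (\<mu> \<Otimes>\<^sub>M lebesgue_on {a..b})"
    unfolding net_solution_def
  proof (intro borel_measurable_sum borel_measurable_times)
    fix j assume "j \<in> {1..J}"
    then have "(\<lambda>y. relu_net \<theta> (vec d y) $ (j - 1)) \<in> borel_measurable \<mu>"
      by (intro relu_net_measurable_unit_cube[OF mu \<theta>(1,2)]) (auto simp: \<theta>(3))
    from measurable_compose[OF measurable_fst this]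
    show "(\<lambda>p. relu_net \<theta> (vec d (fst p)) $ (j - 1)) \<in> borel_measurable (\<mu> \<Otimes>\<^sub>M lebesgue_on {a..b})" .
    show "(\<lambda>p. indicator (cell a b J j) (snd p) :: real) \<in> borel_measurable (\<mu> \<Otimes>\<^sub>M lebesgue_on {a..b})"
      by (rule measurable_compose[OF measurable_snd indicator_cell_measurable])
  qed
  with v' have "(\<lambda>p. \<bar>v (snd p) (fst p) - net_solution a b d J \<theta> (snd p) (fst p)\<bar>)
      \<in> borel_measurable (\<mu> \<Otimes>\<^sub>M lebesgue_on {a..b})"
    by measurable
  then show ?thesis
    unfolding L1_dist_def by (intro borel_measurable_lebesgue_integral) (simp add: case_prod_beta)
qed

section \<open>Assembling the cover error and the sampling error\<close>

theorem corollary4p3: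
  fixes R a b \<alpha> \<beta> T lam :: real
    and k d J W L M :: nat
    and l :: "nat list"
    and \<Theta> :: "params set"
    and \<mu> :: "(nat \<Rightarrow> real) measure"
    and f :: "real \<Rightarrow> (nat \<Rightarrow> real) \<Rightarrow> real"
    and u0 :: "real \<Rightarrow> (nat \<Rightarrow> real) \<Rightarrow> real"
    and u :: "real \<Rightarrow> real \<Rightarrow> (nat \<Rightarrow> real) \<Rightarrow> real"
    and \<R> :: "params \<Rightarrow> real"
    and \<theta>s :: "(nat \<Rightarrow> nat \<Rightarrow> real) \<Rightarrow> params"
  assumes R: "1 \<le> R"
    and pos: "0 < k" "0 < d" "0 < W" "0 < L" "0 < M"
    and ab: "a < b"
    and clip: "1 \<le> \<beta> - \<alpha>"
    and arch: "architecture l" "hd l = d" "last l = J" "num_params l = k"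
    and Theta: "\<Theta> \<subseteq> params_of l"
      "\<And>\<theta>. \<theta> \<in> \<Theta> \<Longrightarrow> clipped \<alpha> \<beta> d \<theta>"
      "\<And>\<theta>. \<theta> \<in> \<Theta> \<Longrightarrow> max_width \<theta> \<le> W"
      "\<And>\<theta>. \<theta> \<in> \<Theta> \<Longrightarrow> depth \<theta> \<le> L"
      "\<And>\<theta>. \<theta> \<in> \<Theta> \<Longrightarrow> weight_magnitude \<theta> \<le> R"
    and mu: "prob_space \<mu>" "complete_measure \<mu>" "space \<mu> = unit_cube d"
      "sets (\<Pi>\<^sub>M i\<in>{..<d}. restrict_space borel {0..1}) \<subseteq> sets \<mu>"
    and T: "0 < T"
    and sol: "\<And>y. y \<in> unit_cube d \<Longrightarrow>
      entropy_solution T a b (\<lambda>v. f v y) (\<lambda>x. u0 x y) (\<lambda>t x. u t x y)"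
    and sol_meas: "(\<lambda>(x, y). u T x y) \<in> borel_measurable (lebesgue_on {a..b} \<Otimes>\<^sub>M \<mu>)"
    and lam: "0 < lam"
    and minimizer: "\<And>S. S \<in> space (\<Pi>\<^sub>M i\<in>{1..M}. \<mu>) \<Longrightarrow>
      is_arg_min (train_loss a b d J (u T) M lam \<R> S) (\<lambda>\<theta>. \<theta> \<in> \<Theta>) (\<theta>s S)"
    and train_meas: "(\<lambda>S. train_error a b d J (u T) M (\<theta>s S) S)
      \<in> borel_measurable (\<Pi>\<^sub>M i\<in>{1..M}. \<mu>)"
    and gen_meas: "(\<lambda>S. gen_error a b d J (u T) \<mu> (\<theta>s S))
      \<in> borel_measurable (\<Pi>\<^sub>M i\<in>{1..M}. \<mu>)"
  shows "cum_gen_error a b d J (u T) \<mu> M \<theta>s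
    \<le> cum_train_error a b d J (u T) \<mu> M \<theta>s
      + 12 * (\<beta> - \<alpha>) * (b - a) * real L * (real W + 1)\<^sup>2 * sqrt (ln (2 * real M * R)) / sqrt (real M)"
proof -
  interpret \<mu>: prob_space \<mu> by (rule mu(1))
  define P where "P = (\<Pi>\<^sub>M i\<in>{1..M}. \<mu>)"
  interpret P: prob_space P unfolding P_def by (intro prob_space_PiM mu(1))
  define X where "X \<theta> y = L1_dist a b (\<lambda>x. u T x y) (\<lambda>x. net_solution a b d J \<theta> x y)" for \<theta> y
  have train: "train_error a b d J (u T) M \<theta> S = (1 / real M) * (\<Sum>i = 1..M. X \<theta> (S i))" for \<theta> S
    by (simp add: train_error_def X_def)
  have gen: "gen_error a b d J (u T) \<mu> \<theta> = \<mu>.expectation (X \<theta>)" for \<theta>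
    by (simp add: gen_error_def X_def[abs_def])
  have \<theta>s: "\<theta>s S \<in> \<Theta>" if "S \<in> space P" for S
    using minimizer that by (simp add: P_def is_arg_min_def)
  \<comment> \<open>A probability space has a point, and its minimizer lies in \<Theta>. The
    resulting \<open>\<theta>0\<close> is the reference for integrability, width and depth.\<close>
  obtain S0 where "S0 \<in> space P" using P.not_empty by blast
  then obtain \<theta>0 where \<theta>0: "\<theta>0 \<in> \<Theta>" using \<theta>s by blast
  have X_meas: "X \<theta> \<in> borel_measurable \<mu>" if "\<theta> \<in> \<Theta>" for \<theta>
    unfolding X_def[abs_def] using Theta(1) that
    by (intro L1_dist_net_measurable[OF mu(3,4) _ arch(2,3) sol_meas]) auto
  have X_diff: "\<bar>X \<theta> y - X \<theta>' y\<bar> \<le> (b - a) * e"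
    if "y \<in> space \<mu>" "0 \<le> e"
      "\<And>j. j < J \<Longrightarrow> \<bar>relu_net \<theta> (vec d y) $ j - relu_net \<theta>' (vec d y) $ j\<bar> \<le> e" for \<theta> \<theta>' y e
    unfolding X_def
  proof (rule L1_dist_diff_le)
    show "integrable (lebesgue_on {a..b}) (\<lambda>x. u T x y)"
      using entropy_solution_integrable[OF sol T] that(1) mu(3) by simp
    show "\<bar>net_solution a b d J \<theta> x y - net_solution a b d J \<theta>' x y\<bar> \<le> e" for x
      using ab that by (intro net_solution_diff_le) auto
  qed (use ab integrable_net_solution in auto)
  \<comment> \<open>\<open>C\<close> will bound the difference of two clipped losses. The inequality
    \<open>b - a \<le> C\<close>, where \<open>1 \<le> \<beta> - \<alpha>\<close> enters, later
    absorbs the cover error, which lacks the factor \<open>\<beta> - \<alpha>\<close>.\<close>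
  define C where "C = (b - a) * (\<beta> - \<alpha>)"
  have C: "0 < C" "b - a \<le> C"
    using ab clip mult_left_mono[of 1 "\<beta> - \<alpha>" "b - a"] by (auto simp: C_def)
  have X_clip: "\<bar>X \<theta> y - X \<theta>' y\<bar> \<le> C" if \<theta>: "\<theta> \<in> \<Theta>" "\<theta>' \<in> \<Theta>" and y: "y \<in> space \<mu>" for \<theta> \<theta>' y
    unfolding C_def
  proof (rule X_diff[OF y])
    fix j assume j: "j < J"
    have "relu_net \<theta>'' (vec d y) $ j \<in> {\<alpha>..\<beta>}" if \<theta>'': "\<theta>'' \<in> \<Theta>" for \<theta>''
    proof -
      have "relu_net \<theta>'' (vec d y) \<in> carrier_vec (last l)"
        using Theta(1) \<theta>'' arch(2) by (intro relu_net_carrier) auto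
      then have "relu_net \<theta>'' (vec d y) $ j \<in> vec_set (relu_net \<theta>'' (vec d y))"
        using j arch(3) by (intro vec_setI) auto
      then show ?thesis using Theta(2)[OF \<theta>''] y mu(3) unfolding clipped_def by blast
    qed
    from this[OF \<theta>(1)] this[OF \<theta>(2)]
    show "\<bar>relu_net \<theta> (vec d y) $ j - relu_net \<theta>' (vec d y) $ j\<bar> \<le> \<beta> - \<alpha>" by auto
  qed (use clip in simp)
  let ?l = "ln (2 * real M * R)"
  \<comment> \<open>One twelfth of the claimed error term; the cover will cost \<open>2 * E\<close>
    and the sampling \<open>4 * E\<close>.\<close>
  define E where "E = C * (real L * (real W + 1)\<^sup>2 * sqrt ?l / sqrt (real M))"
  have "2 * real 1 * 1 \<le> 2 * real M * R" using R pos by (intro mult_mono) auto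
  then have "ln 2 \<le> ?l" by (intro ln_mono) auto
  then have l23: "2 / 3 \<le> ?l" using ln2_ge_two_thirds by linarith
  have E0: "0 \<le> E" using C l23 by (auto simp: E_def)
  have concl: "12 * (\<beta> - \<alpha>) * (b - a) * real L * (real W + 1)\<^sup>2 * sqrt ?l / sqrt (real M) = 12 * E"
    by (simp add: E_def C_def)
  show ?thesis
  proof (cases "integrable \<mu> (X \<theta>0)")
    case False
    \<comment> \<open>Then every generalization error is the junk value 0 of a divergent integral.\<close>
    have "\<not> integrable \<mu> (X \<theta>)" if \<theta>: "\<theta> \<in> \<Theta>" for \<theta>
    proof
      assume int: "integrable \<mu> (X \<theta>)"
      have "integrable \<mu> (\<lambda>y. X \<theta>0 y - X \<theta> y)"
        by (rule \<mu>.integrable_const_bound[where B=C])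
          (auto intro!: AE_I2 X_clip \<theta> \<theta>0 borel_measurable_diff X_meas)
      from Bochner_Integration.integrable_add[OF this int] False show False by simp
    qed
    then have "gen_error a b d J (u T) \<mu> (\<theta>s S) = 0" if "S \<in> space P" for S
      using \<theta>s[OF that] by (simp add: gen not_integrable_integral_eq)
    then have "cum_gen_error a b d J (u T) \<mu> M \<theta>s = (LINT S|P. 0)"
      unfolding cum_gen_error_def P_def[symmetric] by (intro Bochner_Integration.integral_cong) auto
    \<comment> \<open>The integral of a nonnegative function is nonnegative even if it diverges, by
      the same default value.\<close>
    moreover have "0 \<le> cum_train_error a b d J (u T) \<mu> M \<theta>s"
      unfolding cum_train_error_def train_error_def L1_dist_def
      by (intro Bochner_Integration.integral_nonneg mult_nonneg_nonneg sum_nonneg) auto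
    ultimately show ?thesis using E0 unfolding concl by simp
  next
    case True
    have int: "integrable \<mu> (X \<theta>)" if \<theta>: "\<theta> \<in> \<Theta>" for \<theta>
    proof -
      have "integrable \<mu> (\<lambda>y. X \<theta> y - X \<theta>0 y)"
        by (rule \<mu>.integrable_const_bound[where B=C])
          (auto intro!: AE_I2 X_clip \<theta> \<theta>0 borel_measurable_diff X_meas)
      from Bochner_Integration.integrable_add[OF this True] show ?thesis by simp
    qed
    \<comment> \<open>All parameters share the architecture \<open>l\<close>, so the bounds on
      \<open>\<theta>0\<close> alone restrict its widths and depth.\<close>
    have W: "n \<le> W" if "n \<in> set l" for n
      using width_le_max_width[OF _ arch(1) that] Theta(1,3) \<theta>0 by (meson order_trans subsetD)
    have L: "length l - 1 \<le> L"
      using Theta(1) Theta(4)[OF \<theta>0] \<theta>0 by (auto simp: params_of_def depth_def)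
    have k: "k \<le> L * (W * W + W)" using num_params_le[OF W L] arch(4) by simp
    define m where "m = nat \<lceil>4 * R * real L * (R * (real W + 1)) ^ L * real M\<rceil>"
    note num = cover_numerics[OF R pos(3-5) k, folded m_def]
    \<comment> \<open>The mesh in the network outputs, uniform over the cube; in the loss it becomes
      \<open>(b - a) * e\<close>.\<close>
    define e where "e = (R * (real W + 1)) ^ L * (real L * (2 * R / real m))"
    have e: "0 \<le> e" "e \<le> 1 / (2 * real M)" using R num(2) by (auto simp: e_def)
    obtain N where N: "N \<subseteq> \<Theta>" "finite N" "card N \<le> (m + 1) ^ k"
      "\<And>\<theta>. \<theta> \<in> \<Theta> \<Longrightarrow> \<exists>\<theta>'\<in>N. \<forall>v\<in>carrier_vec d. (\<forall>c<d. \<bar>v $ c\<bar> \<le> 1) \<longrightarrow>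
       (\<forall>r<J. \<bar>relu_net \<theta> v $ r - relu_net \<theta>' v $ r\<bar> \<le> e)"
      using net_cover[OF Theta(1,5) R num(1) W L] unfolding arch e_def by blast
    have cover: "\<exists>\<theta>'\<in>N. \<forall>y\<in>space \<mu>. \<bar>X \<theta> y - X \<theta>' y\<bar> \<le> (b - a) * e" if \<theta>: "\<theta> \<in> \<Theta>" for \<theta>
    proof -
      from N(4)[OF \<theta>] obtain \<theta>' where \<theta>': "\<theta>' \<in> N" "\<And>v r. v \<in> carrier_vec d \<Longrightarrow> (\<forall>c<d. \<bar>v $ c\<bar> \<le> 1)
          \<Longrightarrow> r < J \<Longrightarrow> \<bar>relu_net \<theta> v $ r - relu_net \<theta>' v $ r\<bar> \<le> e" by blast
      have "\<bar>X \<theta> y - X \<theta>' y\<bar> \<le> (b - a) * e" if y: "y \<in> space \<mu>" for y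
      proof (rule X_diff[OF y e(1)])
        have "\<bar>vec d y $ c\<bar> \<le> 1" if "c < d" for c
          using y that by (auto simp: mu(3) unit_cube_def PiE_iff abs_le_iff)
        then show "\<bar>relu_net \<theta> (vec d y) $ j - relu_net \<theta>' (vec d y) $ j\<bar> \<le> e" if "j < J" for j
          using that by (intro \<theta>'(2)) auto
      qed
      with \<theta>'(1) show ?thesis by blast
    qed
    define H where "H = 7 * (real L)\<^sup>2 * (real W + 1) ^ 4 * ?l"
    have H: "0 < H" using pos l23 by (simp add: H_def)
    have card0: "0 < card N" using cover[OF \<theta>0] N(2) by (auto simp: card_gt_0_iff)
    have "real (card N) \<le> (real m + 1) ^ k"
      using N(3) by (metis of_nat_le_iff of_nat_power of_nat_add of_nat_1)
    then have "ln (real (card N)) \<le> ln ((real m + 1) ^ k)"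
      using card0 by (intro ln_mono) auto
    also have "\<dots> = real k * ln (real m + 1)" by (rule ln_realpow)
    also have "\<dots> \<le> H" using num(3) by (simp add: H_def)
    finally have lnN: "ln (real (card N)) \<le> H" .
    have "cum_gen_error a b d J (u T) \<mu> M \<theta>s
        \<le> cum_train_error a b d J (u T) \<mu> M \<theta>s + 2 * ((b - a) * e) + C * sqrt (2 * H / real M)"
      unfolding cum_gen_error_def cum_train_error_def train gen
      using \<theta>s train_meas gen_meas unfolding P_def train gen
      by (intro \<mu>.generalization_error_le_cover[OF pos(5) C(1) H int X_clip N(2,1) lnN cover]) auto
    \<comment> \<open>The mesh gives \<open>(b - a) / M\<close>, at most \<open>C / sqrt M\<close>;
      the remaining factor \<open>L * (W + 1)\<^sup>2 * sqrt ?l\<close> is at least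
      \<open>1 / 2\<close>, since \<open>?l \<ge> 2 / 3\<close>.\<close>
    moreover have "2 * ((b - a) * e) \<le> 2 * E"
    proof -
      have sM: "1 \<le> sqrt (real M)" using pos(5) by simp
      have "2 * ((b - a) * e) \<le> 2 * ((b - a) * (1 / (2 * real M)))"
        using e(2) ab by (intro mult_left_mono) auto
      also have "\<dots> = (b - a) / real M" using pos(5) by (simp add: field_simps)
      also have "\<dots> \<le> C / sqrt (real M)"
        using C sM pos(5) mult_left_mono[OF sM, of "sqrt (real M)"] by (intro frac_le) auto
      also have "\<dots> = C * (1 / sqrt (real M))" by simp
      also have "\<dots> \<le> C * (2 * (real L * (real W + 1)\<^sup>2 * sqrt ?l) / sqrt (real M))"
      proof (intro mult_left_mono divide_right_mono)
        have "sqrt ((1 / 2)\<^sup>2) \<le> sqrt ?l"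
          using l23 by (intro real_sqrt_le_mono) (simp add: power2_eq_square)
        then have "1 / 2 \<le> sqrt ?l" by simp
        moreover have "1 \<le> real L * (real W + 1)\<^sup>2"
          using mult_mono[of 1 "real L" 1 "(real W + 1)\<^sup>2"] pos by simp
        ultimately have "1 * (1 / 2) \<le> (real L * (real W + 1)\<^sup>2) * sqrt ?l"
          by (intro mult_mono) auto
        then show "1 \<le> 2 * (real L * (real W + 1)\<^sup>2 * sqrt ?l)" by simp
      qed (use C in auto)
      also have "\<dots> = 2 * E" unfolding E_def by (simp only: times_divide_eq_right mult.left_commute)
      finally show ?thesis .
    qed
    moreover have "C * sqrt (2 * H / real M) \<le> 4 * E"
    proof -
      \<comment> \<open>\<open>2 * H\<close> has the coefficient 14, rounded up to 16 to obtain the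
        root 4.\<close>
      have "sqrt (2 * H / real M) \<le> sqrt ((4 * (real L * (real W + 1)\<^sup>2))\<^sup>2 * ?l / real M)"
        using l23 by (intro real_sqrt_le_mono divide_right_mono)
          (auto simp: H_def power_mult_distrib)
      also have "\<dots> = 4 * (real L * (real W + 1)\<^sup>2 * sqrt ?l / sqrt (real M))"
        by (simp add: real_sqrt_mult real_sqrt_divide)
      finally have "C * sqrt (2 * H / real M)
          \<le> C * (4 * (real L * (real W + 1)\<^sup>2 * sqrt ?l / sqrt (real M)))"
        using C by (intro mult_left_mono) auto
      also have "\<dots> = 4 * E" unfolding E_def by (simp only: mult.left_commute)
      finally show ?thesis .
    qed
    \<comment> \<open>The total is \<open>6 * E\<close>; nonnegativity of \<open>E\<close> covers
      the gap to \<open>12 * E\<close>.\<close>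
    ultimately show ?thesis using E0 unfolding concl by linarith
  qed
qed

end
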